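(* Let $\sigma_0>0$, $\sigma_1>0$, let $g:\mathbb{R}\to\mathbb{R}$ be continuous with $g(\vartheta)>0$ for all $\vartheta$, let $f:\mathbb{R}\to\mathbb{R}$ be continuous with $f(0)=0$, and let $x_0\in\mathbb{R}$. Let $u_{\min,1}\le u_{\min,2}<u_{\max,1}\le u_{\max,2}$ be reals with $u_{\min,1}\neq u_{\min,2}$ or $u_{\max,1}\neq u_{\max,2}$, let $0<t_1<t_2<t_3<t_4$, and let $u:\mathbb{R}^+\to\mathbb{R}$ be a bimodal input as defined in the context (with period $T=t_4$). Consider the LuGre model with input $u$, its hysteresis loop $G_u^\circ$ and its minor loop $\mathcal{N}_u$ as defined in the context. Put $a=\sigma_0/g(0)$ and $$\varrho_0=0,\quad \varrho_1=u_{\max,1}-u_{\min,1},\quad \varrho_2=\varrho_1+u_{\max,1}-u_{\min,2},\quad \varrho_3=\varrho_2+u_{\max,2}-u_{\min,2},\quad \varrho_4=\varrho_3+u_{\max,2}-u_{\min,1},$$ so that $0<\varrho_1<\varrho_2<\varrho_3<\varrho_4$. Define $\psi_u:[0,\varrho_4]\to\mathbb{R}$ by $$\psi_u(t)=\begin{cases} t+u_{\min,1}, & t\in[0,\varrho_1],\\ -t+\varrho_1+u_{\max,1}, & t\in[\varrho_1,\varrho_2],\\ t-\varrho_2+u_{\min,2}, & t\in[\varrho_2,\varrho_3],\\ -t+\varrho_3+u_{\max,2}, & t\in[\varrho_3,\varrho_4].\end{cases}$$ Define $y^\circ:[0,\varrho_4]\to\mathbb{R}$ by $$y^\circ(0)=g(0)\,\frac{\mathrm{e}^{-a\varrho_4}}{1-\mathrm{e}^{-a\varrho_4}}\Big(2\mathrm{e}^{a\varrho_1}-2\mathrm{e}^{a\varrho_2}+2\mathrm{e}^{a\varrho_3}-\mathrm{e}^{a\varrho_4}-1\Big),$$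 $$y^\circ(\varrho_i)=\mathrm{e}^{-a(\varrho_i-\varrho_{i-1})}\Big(y^\circ(\varrho_{i-1})+(-1)^{i-1}g(0)\big[\mathrm{e}^{a(\varrho_i-\varrho_{i-1})}-1\big]\Big),\quad i\in\{1,2,3,4\},$$ and, for $i\in\{0,1,2,3\}$ and $t\in[\varrho_i,\varrho_{i+1}]$, $$y^\circ(t)=\mathrm{e}^{-a(t-\varrho_i)}\Big(y^\circ(\varrho_i)+(-1)^{i}g(0)\big[\mathrm{e}^{a(t-\varrho_i)}-1\big]\Big).$$ Then: (a) the hysteresis loop is $G_u^\circ=\{(\psi_u(t),y^\circ(t)) : t\in[0,\varrho_4]\}$; (b) the minor loop is $\mathcal{N}_u=\{(\psi_u(t),y^\circ(t)) : t\in[\varrho_1,\varrho_5]\}$, where $\varrho_5=u_{\max,1}-u_{\min,2}+\varrho_2\in(\varrho_2,\varrho_3]$.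
   Context: Bimodal input: $u:\mathbb{R}^+\to\mathbb{R}$ is absolutely continuous with $u$ and $\dot u$ essentially bounded (i.e. $u\in W^{1,\infty}(\mathbb{R}^+,\mathbb{R})$), $t_4$-periodic, strictly increasing on $[0,t_1]$, strictly decreasing on $[t_1,t_2]$, strictly increasing on $[t_2,t_3]$, strictly decreasing on $[t_3,t_4]$, with $u(0)=u_{\min,1}$, $u(t_1)=u_{\max,1}$, $u(t_2)=u_{\min,2}$, $u(t_3)=u_{\max,2}$, $u(t_4)=u(0)$. LuGre model: state $x$ and output $F$ given by $\dot x(t)=-\sigma_0\frac{|\dot u(t)|}{g(\dot u(t))}x(t)+\dot u(t)$, $x(0)=x_0$, $F(t)=\sigma_0x(t)+\sigma_1\dot x(t)+f(\dot u(t))$ (Carathéodory solutions). For $\gamma>0$, applying the slowed input $t\mapsto u(t/\gamma)$ and rescaling time back gives the system $\dot z_\gamma(t)=-\sigma_0\frac{|\dot u(t)|}{g(\dot u(t)/\gamma)}z_\gamma(t)+\dot u(t)$, $z_\gamma(0)=x_0$, with output $y_\gamma(t)=\sigma_0 z_\gamma(t)+\frac{\sigma_1}{\gamma}\dot z_\gamma(t)+f(\dot u(t)/\gamma)$. It is known (from prior work) that $y_\gamma$ converges in $L^\infty(\mathbb{R}^+,\mathbb{R})$ as $\gamma\to\infty$ to a function $y^\star_u$, and that, with $T=t_4$, the functions $y^\star_{u,k}(t)=y^\star_u(t+kT)$, $t\in[0,T]$, converge in $L^\infty([0,T],\mathbb{R})$ as $k\to\infty$ to a function $y^\circ_u$.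 The hysteresis loop corresponding to $u$ is $G_u^\circ=\{(u(t),y^\circ_u(t)) : t\in[0,T]\}$. The minor loop corresponding to $u$ is the portion $\mathcal{N}_u=\{(u(t),y^\circ_u(t)) : t\in[t_1,t_5]\}$, where $t_5\in(t_2,t_3]$ is the time with $u(t_5)=u(t_1)$. *)

theory Defs
  imports "HOL-Analysis.Analysis"
begin

text \<open>Right-hand side of the (time-rescaled) LuGre state equation,
  dz/dt = -sigma0 |du| / g(du/gamma) z + du.\<close>
definition lugre_rhs ::
  "real \<Rightarrow> (real \<Rightarrow> real) \<Rightarrow> (real \<Rightarrow> real) \<Rightarrow> real \<Rightarrow> (real \<Rightarrow> real) \<Rightarrow> real \<Rightarrow> real" where
  "lugre_rhs \<sigma>0 g du \<gamma> z s = - \<sigma>0 * \<bar>du s\<bar> / g (du s / \<gamma>) * z s + du s"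

text \<open>Output y_gamma = sigma0 z + (sigma1/gamma) dz/dt + f(du/gamma),
  with dz/dt replaced by the right-hand side (equal a.e.).\<close>
definition lugre_out ::
  "real \<Rightarrow> real \<Rightarrow> (real \<Rightarrow> real) \<Rightarrow> (real \<Rightarrow> real) \<Rightarrow> (real \<Rightarrow> real) \<Rightarrow> real \<Rightarrow> (real \<Rightarrow> real) \<Rightarrow> real \<Rightarrow> real" where
  "lugre_out \<sigma>0 \<sigma>1 g f du \<gamma> z t =
     \<sigma>0 * z t + \<sigma>1 / \<gamma> * lugre_rhs \<sigma>0 g du \<gamma> z t + f (du t / \<gamma>)"

definition lg_rho :: "real \<Rightarrow> real \<Rightarrow> real \<Rightarrow> real \<Rightarrow> nat \<Rightarrow> real" where
  "lg_rho m1 M1 m2 M2 i =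
     (let r1 = M1 - m1; r2 = r1 + M1 - m2; r3 = r2 + M2 - m2; r4 = r3 + M2 - m1
      in if i = 0 then 0 else if i = 1 then r1 else if i = 2 then r2 else if i = 3 then r3 else r4)"

definition lg_psi :: "real \<Rightarrow> real \<Rightarrow> real \<Rightarrow> real \<Rightarrow> real \<Rightarrow> real" where
  "lg_psi m1 M1 m2 M2 t =
     (let r = lg_rho m1 M1 m2 M2
      in if t \<le> r 1 then t + m1
         else if t \<le> r 2 then - t + r 1 + M1
         else if t \<le> r 3 then t - r 2 + m2
         else - t + r 3 + M2)"

text \<open>Values y(rho_i), with a = sigma0/g(0), G = g(0).\<close>
fun lg_node :: "real \<Rightarrow> real \<Rightarrow> (nat \<Rightarrow> real) \<Rightarrow> nat \<Rightarrow> real" where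
  "lg_node a G r 0 =
     G * (exp (- a * r 4) / (1 - exp (- a * r 4))) *
       (2 * exp (a * r 1) - 2 * exp (a * r 2) + 2 * exp (a * r 3) - exp (a * r 4) - 1)"
| "lg_node a G r (Suc i) =
     exp (- a * (r (Suc i) - r i)) *
       (lg_node a G r i + (-1) ^ i * G * (exp (a * (r (Suc i) - r i)) - 1))"

definition lg_y :: "real \<Rightarrow> real \<Rightarrow> (nat \<Rightarrow> real) \<Rightarrow> real \<Rightarrow> real" where
  "lg_y a G r t =
     (let seg = (\<lambda>i. exp (- a * (t - r i)) *
                      (lg_node a G r i + (-1) ^ i * G * (exp (a * (t - r i)) - 1)))
      in if t \<le> r 1 then seg 0
         else if t \<le> r 2 then seg 1
         else if t \<le> r 3 then seg 2
         else seg 3)"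

end

theory Submission
  imports Defs
begin

text \<open>
  Let \<open>v\<close> be the total variation of \<open>u\<close> on \<open>[0, t]\<close>. Since \<open>du\<close> is bounded, \<open>g (du / \<gamma>)\<close> tends
  uniformly to \<open>g 0\<close>, so the states \<open>z \<gamma>\<close> tend to the solution of \<open>dx = - a x dv + du\<close>, which variation
  of constants gives explicitly, and the limit output is \<open>\<sigma>0 x\<close>. Where \<open>u\<close> is monotone,
  \<open>du = \<plusminus> dv\<close>, so the output is a function of \<open>v\<close> solving \<open>dy = (- a y \<plusminus> \<sigma>0) dv\<close>, whose solutions are
  the exponential segments of \<open>lg_y\<close>. Two solutions differ by a multiple of \<open>exp (- a v)\<close>; hence
  after each period the output gets closer to the periodic solution \<open>lg_y \<circ> v\<close> by the factor
  \<open>exp (- a \<rho>\<^sub>4)\<close>. Finally \<open>u = lg_psi \<circ> v\<close>, and \<open>v\<close> maps \<open>[0, t\<^sub>4]\<close> onto \<open>[0, \<rho>\<^sub>4]\<close>.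
\<close>

section \<open>Calculus of indefinite integrals of bounded functions\<close>

text \<open>
  The integrands are only measurable, but identities between indefinite integrals can still be
  proved without differentiation almost everywhere: if the increments of the difference of both
  sides are of second order, that difference has derivative zero at every point.
\<close>

lemma quadratic_increments_imp_const:
  fixes D :: "real \<Rightarrow> real"
  assumes ab: "a \<le> b"
    and D: "\<And>s t. \<lbrakk>a \<le> s; s \<le> t; t \<le> b\<rbrakk> \<Longrightarrow> \<bar>D t - D s\<bar> \<le> C * (t - s)\<^sup>2"
  shows "D b = D a"
proof -
  have "\<exists>c. \<forall>x\<in>{a..b}. D x = c"
  proof (rule has_field_derivative_zero_constant)
    fix x assume x: "x \<in> {a..b}"
    have *: "\<bar>(D y - D x) / (y - x)\<bar> \<le> \<bar>C\<bar> * \<bar>y - x\<bar>" if y: "y \<in> {a..b}" for y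
    proof -
      have "\<bar>D y - D x\<bar> \<le> C * (y - x)\<^sup>2"
        using D[of x y] D[of y x] x y by (cases "x \<le> y") (auto simp: power2_commute abs_minus_commute)
      also have "\<dots> \<le> \<bar>C\<bar> * \<bar>y - x\<bar> * \<bar>y - x\<bar>"
        by (simp add: power2_eq_square mult.assoc mult_right_mono)
      finally show ?thesis
        by (cases "y = x") (auto simp: field_simps)
    qed
    have "((\<lambda>y. \<bar>C\<bar> * \<bar>y - x\<bar>) \<longlongrightarrow> \<bar>C\<bar> * \<bar>x - x\<bar>) (at x within {a..b})"
      by (intro tendsto_intros)
    then have "((\<lambda>y. \<bar>C\<bar> * \<bar>y - x\<bar>) \<longlongrightarrow> 0) (at x within {a..b})"
      by simp
    then have "((\<lambda>y. (D y - D x) / (y - x)) \<longlongrightarrow> 0) (at x within {a..b})"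
      by (rule Lim_null_comparison[rotated]) (auto simp: eventually_at_filter * simp del: abs_divide)
    then show "(D has_field_derivative 0) (at x within {a..b})"
      by (simp add: has_field_derivative_iff)
  qed (simp add: convex_real_interval)
  then show ?thesis using ab by auto
qed

lemma integrable_continuous_mult_bounded:
  fixes c f :: "real \<Rightarrow> real"
  assumes "continuous_on {a..b} c" "f integrable_on {a..b}" "\<And>x. x \<in> {a..b} \<Longrightarrow> \<bar>f x\<bar> \<le> M"
  shows "(\<lambda>x. c x * f x) integrable_on {a..b}"
proof -
  have "f absolutely_integrable_on {a..b}"
    by (rule absolutely_integrable_integrable_bound[of _ _ "\<lambda>_. M"]) (use assms in auto)
  moreover have "bounded (c ` {a..b})"
    by (intro compact_imp_bounded compact_continuous_image assms) simp
  ultimately have "(\<lambda>x. c x * f x) absolutely_integrable_on {a..b}"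
    by (intro absolutely_integrable_bounded_measurable_product_real
        continuous_imp_measurable_on_sets_lebesgue assms) auto
  then show ?thesis
    using absolutely_integrable_on_def by blast
qed

lemma abs_integral_le_interval:
  fixes f :: "real \<Rightarrow> real"
  assumes "a \<le> b" "f integrable_on {a..b}" "\<And>x. x \<in> {a..b} \<Longrightarrow> \<bar>f x\<bar> \<le> M"
  shows "\<bar>integral {a..b} f\<bar> \<le> M * (b - a)"
proof -
  have "norm (integral {a..b} f) \<le> integral {a..b} (\<lambda>_. M)"
    by (rule integral_norm_bound_integral) (use assms in auto)
  then show ?thesis using assms(1) by (simp add: mult.commute)
qed

lemma integral_diff_initial:
  fixes f :: "real \<Rightarrow> real"
  assumes "f integrable_on {a..b}" "a \<le> s" "s \<le> t" "t \<le> b"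
  shows "integral {a..t} f - integral {a..s} f = integral {s..t} f"
proof -
  have "f integrable_on {a..t}"
    by (rule integrable_subinterval_real[OF assms(1)]) (use assms in auto)
  from Henstock_Kurzweil_Integration.integral_combine[OF assms(2,3) this] show ?thesis by simp
qed

lemma lipschitz_imp_continuous_on_interval:
  fixes c :: "real \<Rightarrow> real"
  assumes "\<And>s t. \<lbrakk>a \<le> s; s \<le> t; t \<le> b\<rbrakk> \<Longrightarrow> \<bar>c t - c s\<bar> \<le> L * (t - s)"
  shows "continuous_on {a..b} c"
proof -
  have "\<bar>L\<bar>-lipschitz_on {a..b} c"
  proof (rule lipschitz_onI)
    fix x y assume xy: "x \<in> {a..b}" "y \<in> {a..b}"
    have "\<bar>c x - c y\<bar> \<le> L * \<bar>x - y\<bar>"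
      using assms[of x y] assms[of y x] xy by (cases "x \<le> y") (auto simp: abs_minus_commute)
    also have "\<dots> \<le> \<bar>L\<bar> * \<bar>x - y\<bar>"
      by (intro mult_right_mono) auto
    finally show "dist (c x) (c y) \<le> \<bar>L\<bar> * dist x y"
      by (simp add: dist_real_def)
  qed simp
  then show ?thesis by (rule lipschitz_on_continuous_on)
qed

text \<open>Since \<open>c\<close> is Lipschitz, freezing it at the left end of
  \<open>[s, t]\<close> changes the integral of \<open>c x * f x\<close> by at most
  \<open>\<bar>L\<bar> * M * (t - s)\<^sup>2\<close>. A candidate primitive \<open>H\<close>
  therefore need only be tested, up to second order, against \<open>c s\<close> times the integral
  of \<open>f\<close>.\<close>

lemma integral_weighted_eq_increment:
  fixes c f H :: "real \<Rightarrow> real"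
  assumes ab: "a \<le> b" and f: "f integrable_on {a..b}" "\<And>x. x \<in> {a..b} \<Longrightarrow> \<bar>f x\<bar> \<le> M"
    and c: "\<And>s t. \<lbrakk>a \<le> s; s \<le> t; t \<le> b\<rbrakk> \<Longrightarrow> \<bar>c t - c s\<bar> \<le> L * (t - s)"
    and H: "\<And>s t. \<lbrakk>a \<le> s; s \<le> t; t \<le> b\<rbrakk> \<Longrightarrow> \<bar>H t - H s - c s * integral {s..t} f\<bar> \<le> C * (t - s)\<^sup>2"
  shows "integral {a..b} (\<lambda>x. c x * f x) = H b - H a"
proof -
  have cont: "continuous_on {a..b} c"
    using c by (rule lipschitz_imp_continuous_on_interval)
  have cf: "(\<lambda>x. c x * f x) integrable_on {a..b}"
    by (rule integrable_continuous_mult_bounded[OF cont f])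
  have M: "0 \<le> M" using f(2)[of a] ab by force
  define D where "D t = H t - integral {a..t} (\<lambda>x. c x * f x)" for t
  have "D b = D a"
  proof (rule quadratic_increments_imp_const[OF ab])
    fix s t assume st: "a \<le> s" "s \<le> t" "t \<le> b"
    have sub: "f integrable_on {s..t}" "(\<lambda>x. c x * f x) integrable_on {s..t}"
      by (rule integrable_subinterval_real[OF f(1)] integrable_subinterval_real[OF cf]; use st in auto)+
    have diff: "integral {s..t} (\<lambda>x. (c x - c s) * f x) =
        integral {s..t} (\<lambda>x. c x * f x) - c s * integral {s..t} f"
      unfolding left_diff_distrib
      by (subst Henstock_Kurzweil_Integration.integral_diff) (use sub in \<open>auto intro: integrable_on_mult_right\<close>)
    have "\<bar>integral {s..t} (\<lambda>x. (c x - c s) * f x)\<bar> \<le> (\<bar>L\<bar> * (t - s) * M) * (t - s)"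
    proof (rule abs_integral_le_interval[OF st(2)])
      show "(\<lambda>x. (c x - c s) * f x) integrable_on {s..t}"
        unfolding left_diff_distrib by (intro integrable_diff sub integrable_on_mult_right)
      fix x assume x: "x \<in> {s..t}"
      have "\<bar>c x - c s\<bar> \<le> L * (x - s)" using c x st by auto
      also have "\<dots> \<le> \<bar>L\<bar> * (t - s)" using x by (intro mult_mono) auto
      finally show "\<bar>(c x - c s) * f x\<bar> \<le> \<bar>L\<bar> * (t - s) * M"
        unfolding abs_mult using f(2)[of x] x st M by (intro mult_mono) auto
    qed
    then have "\<bar>integral {s..t} (\<lambda>x. c x * f x) - c s * integral {s..t} f\<bar> \<le> \<bar>L\<bar> * M * (t - s)\<^sup>2"
      unfolding diff by (simp add: power2_eq_square mult_ac)
    moreover have "D t - D s = H t - H s - integral {s..t} (\<lambda>x. c x * f x)"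
      unfolding D_def using integral_diff_initial[OF cf st] by simp
    ultimately show "\<bar>D t - D s\<bar> \<le> (C + \<bar>L\<bar> * M) * (t - s)\<^sup>2"
      using H[OF st] by (simp add: distrib_right)
  qed
  then show ?thesis by (simp add: D_def)
qed

lemma integral_product_rule:
  fixes F G f g :: "real \<Rightarrow> real"
  assumes ab: "a \<le> b"
    and f: "f integrable_on {a..b}" "\<And>x. x \<in> {a..b} \<Longrightarrow> \<bar>f x\<bar> \<le> M"
    and g: "g integrable_on {a..b}" "\<And>x. x \<in> {a..b} \<Longrightarrow> \<bar>g x\<bar> \<le> N"
    and F: "\<And>t. t \<in> {a..b} \<Longrightarrow> F t = F a + integral {a..t} f"
    and G: "\<And>t. t \<in> {a..b} \<Longrightarrow> G t = G a + integral {a..t} g"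
  shows "F b * G b - F a * G a = integral {a..b} (\<lambda>x. F x * g x + G x * f x)"
proof -
  have dF: "F t - F s = integral {s..t} f" if "a \<le> s" "s \<le> t" "t \<le> b" for s t
    using integral_diff_initial[OF f(1) that] F[of s] F[of t] that by simp
  have dG: "G t - G s = integral {s..t} g" if "a \<le> s" "s \<le> t" "t \<le> b" for s t
    using integral_diff_initial[OF g(1) that] G[of s] G[of t] that by simp
  have sub: "f integrable_on {s..t}" "g integrable_on {s..t}" if "a \<le> s" "s \<le> t" "t \<le> b" for s t
    by (rule integrable_subinterval_real[OF f(1)] integrable_subinterval_real[OF g(1)]; use that in auto)+
  have lF: "\<bar>F t - F s\<bar> \<le> M * (t - s)" if "a \<le> s" "s \<le> t" "t \<le> b" for s t
    unfolding dF[OF that] by (rule abs_integral_le_interval) (use that f(2) sub in auto)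
  have lG: "\<bar>G t - G s\<bar> \<le> N * (t - s)" if "a \<le> s" "s \<le> t" "t \<le> b" for s t
    unfolding dG[OF that] by (rule abs_integral_le_interval) (use that g(2) sub in auto)
  have cF: "continuous_on {a..b} F" and cG: "continuous_on {a..b} G"
    using lF lG by (blast intro: lipschitz_imp_continuous_on_interval)+
  have Fg: "(\<lambda>x. F x * g x) integrable_on {a..b}" and Gf: "(\<lambda>x. G x * f x) integrable_on {a..b}"
    using integrable_continuous_mult_bounded[OF cF g] integrable_continuous_mult_bounded[OF cG f]
    by auto
  have M: "0 \<le> M" and N: "0 \<le> N" using f(2)[of a] g(2)[of a] ab by force+
  \<comment> \<open>With \<open>H\<close> as the candidate primitive of \<open>F * g\<close>, its
    error on \<open>[s, t]\<close> is exactly the integral of \<open>(G t - G x) * f x\<close>,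
    which is of second order because \<open>G\<close> is Lipschitz.\<close>
  define H where "H t = F t * G t - integral {a..t} (\<lambda>x. G x * f x)" for t
  have "integral {a..b} (\<lambda>x. F x * g x) = H b - H a"
  proof (rule integral_weighted_eq_increment[OF ab g lF])
    fix s t assume st: "a \<le> s" "s \<le> t" "t \<le> b"
    have "\<bar>integral {s..t} (\<lambda>x. (G t - G x) * f x)\<bar> \<le> (N * (t - s) * M) * (t - s)"
    proof (rule abs_integral_le_interval[OF st(2)])
      show "(\<lambda>x. (G t - G x) * f x) integrable_on {s..t}"
        unfolding left_diff_distrib
        by (intro integrable_diff integrable_on_mult_right sub(1)[OF st] integrable_subinterval_real[OF Gf])
          (use st in auto)
      fix x assume x: "x \<in> {s..t}"
      have "\<bar>G t - G x\<bar> \<le> N * (t - x)" using lG x st by auto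
      also have "\<dots> \<le> N * (t - s)" using x N by (intro mult_mono) auto
      finally show "\<bar>(G t - G x) * f x\<bar> \<le> N * (t - s) * M"
        unfolding abs_mult using f(2)[of x] x st M N by (intro mult_mono) auto
    qed
    moreover have "integral {s..t} (\<lambda>x. (G t - G x) * f x) =
        G t * integral {s..t} f - integral {s..t} (\<lambda>x. G x * f x)"
      unfolding left_diff_distrib
      by (subst Henstock_Kurzweil_Integration.integral_diff)
        (use sub[OF st] integrable_subinterval_real[OF Gf, of s t] st in \<open>auto intro: integrable_on_mult_right\<close>)
    moreover have "H t - H s - F s * integral {s..t} g =
        G t * integral {s..t} f - integral {s..t} (\<lambda>x. G x * f x)"
      unfolding H_def dF[OF st, symmetric] dG[OF st, symmetric]
      using integral_diff_initial[OF Gf st] by (simp add: algebra_simps)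
    ultimately show "\<bar>H t - H s - F s * integral {s..t} g\<bar> \<le> (N * M) * (t - s)\<^sup>2"
      by (simp add: power2_eq_square mult_ac)
  qed
  then show ?thesis
    unfolding H_def by (subst Henstock_Kurzweil_Integration.integral_add[OF Fg Gf]) simp
qed

text \<open>
  By Henstock's lemma the Riemann sums of \<open>\<bar>f\<bar>\<close> over a fine division are close to the sum of the
  moduli of the integrals of \<open>f\<close> over its pieces, and these are nonnegative.
\<close>

lemma integral_abs_eq_integral:
  fixes f :: "real \<Rightarrow> real"
  assumes ab: "a \<le> b" and f: "f integrable_on {a..b}" and af: "(\<lambda>x. \<bar>f x\<bar>) integrable_on {a..b}"
    and nonneg: "\<And>s t. \<lbrakk>a \<le> s; s \<le> t; t \<le> b\<rbrakk> \<Longrightarrow> 0 \<le> integral {s..t} f"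
  shows "integral {a..b} (\<lambda>x. \<bar>f x\<bar>) = integral {a..b} f"
proof (rule antisym)
  show "integral {a..b} f \<le> integral {a..b} (\<lambda>x. \<bar>f x\<bar>)"
    by (intro integral_le f af) auto
  show "integral {a..b} (\<lambda>x. \<bar>f x\<bar>) \<le> integral {a..b} f"
  proof (rule field_le_epsilon)
    fix e :: real assume e: "0 < e"
    obtain d1 where d1: "gauge d1"
      "\<And>p. \<lbrakk>p tagged_partial_division_of (cbox a b); d1 fine p\<rbrakk> \<Longrightarrow>
          (\<Sum>(x,k)\<in>p. norm (measure lborel k *\<^sub>R f x - integral k f)) < e / 2"
      using Henstock_lemma[of f a b "e / 2"] f e by (auto simp: cbox_interval)
    have "((\<lambda>x. \<bar>f x\<bar>) has_integral integral {a..b} (\<lambda>x. \<bar>f x\<bar>)) (cbox a b)"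
      using af by (simp add: cbox_interval integrable_integral)
    then obtain d2 where d2: "gauge d2"
      "\<And>p. \<lbrakk>p tagged_division_of (cbox a b); d2 fine p\<rbrakk> \<Longrightarrow>
         norm ((\<Sum>(x,k)\<in>p. measure lborel k *\<^sub>R \<bar>f x\<bar>) - integral {a..b} (\<lambda>x. \<bar>f x\<bar>)) < e / 2"
      using e unfolding has_integral by (metis half_gt_zero)
    \<comment> \<open>One division fine for both gauges, so that both estimates concern the same
      tags and pieces.\<close>
    obtain p where p: "p tagged_division_of (cbox a b)" "(\<lambda>x. d1 x \<inter> d2 x) fine p"
      using fine_division_exists[OF gauge_Int[OF d1(1) d2(1)]] by blast
    have fine: "d1 fine p" "d2 fine p" using p(2) by (auto simp: fine_Int)
    have "(\<Sum>(x,k)\<in>p. measure lborel k *\<^sub>R \<bar>f x\<bar>) \<le>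
        (\<Sum>(x,k)\<in>p. integral k f + norm (measure lborel k *\<^sub>R f x - integral k f))"
    proof (rule sum_mono, clarify)
      fix x k assume xk: "(x, k) \<in> p"
      obtain s t where k: "k = cbox s t" using tagged_division_ofD(4)[OF p(1) xk] by blast
      have "x \<in> k" "k \<subseteq> cbox a b" using tagged_division_ofD(2,3)[OF p(1) xk] by auto
      then have "0 \<le> integral k f"
        using nonneg[of s t] by (auto simp: k cbox_interval)
      moreover have "measure lborel k *\<^sub>R \<bar>f x\<bar> = \<bar>measure lborel k * f x\<bar>"
        by (simp add: abs_mult)
      ultimately show "measure lborel k *\<^sub>R \<bar>f x\<bar> \<le> integral k f + norm (measure lborel k *\<^sub>R f x - integral k f)"
        by auto
    qed
    also have "\<dots> = (\<Sum>(x,k)\<in>p. integral k f) + (\<Sum>(x,k)\<in>p. norm (measure lborel k *\<^sub>R f x - integral k f))"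
      by (simp add: split_def sum.distrib)
    also have "(\<Sum>(x,k)\<in>p. integral k f) = integral {a..b} f"
      using integral_combine_tagged_division_topdown[of f a b p] f p(1) by (simp add: cbox_interval)
    finally have "(\<Sum>(x,k)\<in>p. measure lborel k *\<^sub>R \<bar>f x\<bar>) \<le> integral {a..b} f +
        (\<Sum>(x,k)\<in>p. norm (measure lborel k *\<^sub>R f x - integral k f))" .
    moreover have "p tagged_partial_division_of (cbox a b)"
      using p(1) by (simp add: tagged_division_of_def)
    note d1(2)[OF this fine(1)]
    moreover note d2(2)[OF p(1) fine(2)]
    ultimately show "integral {a..b} (\<lambda>x. \<bar>f x\<bar>) \<le> integral {a..b} f + e"
      unfolding real_norm_def by linarith
  qed
qed

text \<open>The second bound is \<open>1 - x \<le> exp (- x)\<close> multiplied by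
  \<open>exp x\<close>; the third is \<open>x\<close> times the second, added to the second.\<close>

lemma exp_minus_one_bound:
  fixes x :: real
  assumes "0 \<le> x"
  shows "0 \<le> exp x - 1 - x" "exp x - 1 \<le> x * exp x" "exp x - 1 - x \<le> x\<^sup>2 * exp x"
proof -
  show "0 \<le> exp x - 1 - x" using exp_ge_add_one_self[of x] by linarith
  have "(1 - x) * exp x \<le> exp (- x) * exp x"
    using exp_ge_add_one_self[of "-x"] by (intro mult_right_mono) auto
  then show *: "exp x - 1 \<le> x * exp x" by (simp add: algebra_simps flip: exp_add)
  have "x * (exp x - 1) \<le> x * (x * exp x)" by (intro mult_left_mono * assms)
  with * show "exp x - 1 - x \<le> x\<^sup>2 * exp x" by (simp add: algebra_simps power2_eq_square)
qed

section \<open>The closed-form loop\<close>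

text \<open>The solution of \<open>y' = - a * y + (-1) ^ i * a * G\<close> that starts at
  \<open>r i\<close> with value \<open>lg_node a G r i\<close>; for \<open>G = \<sigma>0 / a\<close>
  the forcing is \<open>\<sigma>0\<close> up to sign.\<close>

definition lg_seg :: "real \<Rightarrow> real \<Rightarrow> (nat \<Rightarrow> real) \<Rightarrow> nat \<Rightarrow> real \<Rightarrow> real" where
  "lg_seg a G r i t = exp (- a * (t - r i)) * (lg_node a G r i + (-1) ^ i * G * (exp (a * (t - r i)) - 1))"

lemma lg_node_Suc_eq_seg: "lg_node a G r (Suc i) = lg_seg a G r i (r (Suc i))"
  by (simp add: lg_seg_def)

lemma lg_seg_start: "lg_seg a G r i (r i) = lg_node a G r i"
  by (simp add: lg_seg_def)

lemma lg_y_eq_seg: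
  assumes mono: "strict_mono_on {..4} r" and i: "i < 4" and x: "r i \<le> x" "x \<le> r (Suc i)"
  shows "lg_y a G r x = lg_seg a G r i x"
proof (cases "i = 0 \<or> r i < x")
  case True
  have "r 1 < r 2" "r 2 < r 3" using strict_mono_onD[OF mono] by auto
  moreover from i have "i = 0 \<or> i = 1 \<or> i = 2 \<or> i = 3" by arith
  ultimately show ?thesis using x True
    by (auto simp: lg_y_def lg_seg_def numeral_2_eq_2 numeral_3_eq_3 simp del: lg_node.simps)
next
  \<comment> \<open>At an inner breakpoint \<open>lg_y\<close> uses the segment that ends there, not
    the one that starts; the two agree because the recursion of \<open>lg_node\<close> yields the
    end value of the preceding segment.\<close>
  case False
  then have xi: "x = r i" and "0 < i" using x by auto
  then obtain j where j: "i = Suc j" by (cases i) auto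
  have r: "r 0 < r 1" "r 1 < r 2" "r 2 < r 3" using strict_mono_onD[OF mono] by auto
  from i j have "j = 0 \<or> j = 1 \<or> j = 2" by arith
  then have "lg_y a G r x = lg_seg a G r j (r (Suc j))"
    using r by (auto simp: xi j lg_y_def lg_seg_def numeral_2_eq_2 numeral_3_eq_3 simp del: lg_node.simps)
  then show ?thesis
    by (simp only: xi j lg_seg_start lg_node_Suc_eq_seg)
qed

text \<open>The starting value is the one that closes the loop after a period. Multiplied by
  \<open>exp (a * r i)\<close>, the recursion telescopes, and its increments add up to
  \<open>G\<close> times the bracket in that value.\<close>

lemma lg_node_4:
  assumes r0: "r 0 = 0" and nz: "a * r 4 \<noteq> 0"
  shows "lg_node a G r 4 = lg_node a G r 0"
proof -
  have step: "exp (a * r (Suc i)) * lg_node a G r (Suc i) =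
      exp (a * r i) * lg_node a G r i + (-1) ^ i * G * (exp (a * r (Suc i)) - exp (a * r i))" for i
  proof -
    have "exp (a * r (Suc i)) * exp (- a * (r (Suc i) - r i)) = exp (a * r i)"
      and e: "exp (a * r (Suc i)) = exp (a * r i) * exp (a * (r (Suc i) - r i))"
      by (simp_all add: algebra_simps flip: exp_add)
    then have "exp (a * r (Suc i)) * lg_node a G r (Suc i) =
        exp (a * r i) * (lg_node a G r i + (-1) ^ i * G * (exp (a * (r (Suc i) - r i)) - 1))"
      by (simp only: lg_node.simps(2) mult.assoc[symmetric])
    then show ?thesis
      unfolding e by (simp only: algebra_simps)
  qed
  define Q where "Q = 2 * exp (a * r 1) - 2 * exp (a * r 2) + 2 * exp (a * r 3) - exp (a * r 4) - 1"
  have n4: "exp (a * r 4) * lg_node a G r 4 = lg_node a G r 0 + G * Q"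
    using step[of 0] step[of 1] step[of 2] step[of 3] r0 unfolding Q_def
    by (simp add: eval_nat_numeral algebra_simps del: lg_node.simps)
  have "exp (a * r 4) \<noteq> 1" using nz by simp
  \<comment> \<open>In this form the prefactor shows that the starting value solves the fixed point
    equation \<open>exp (a * r 4) * y = y + G * Q\<close>.\<close>
  then have "exp (- a * r 4) / (1 - exp (- a * r 4)) = 1 / (exp (a * r 4) - 1)"
    by (simp add: exp_minus field_simps)
  then have "lg_node a G r 0 * (exp (a * r 4) - 1) = G * Q"
    using \<open>exp (a * r 4) \<noteq> 1\<close> by (simp add: Q_def)
  with n4 have "exp (a * r 4) * lg_node a G r 4 = exp (a * r 4) * lg_node a G r 0"
    by (simp add: algebra_simps del: lg_node.simps)
  then show ?thesis by (simp del: lg_node.simps)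
qed

section \<open>The limit state\<close>

locale bounded_rate =
  fixes du :: "real \<Rightarrow> real" and M :: real
  assumes du_measurable: "du \<in> borel_measurable lborel"
    and du_bounded: "\<bar>du t\<bar> \<le> M"
begin

section \<open>The variation as a clock\<close>

definition var :: "real \<Rightarrow> real" where
  "var t = integral {0..t} (\<lambda>s. \<bar>du s\<bar>)"

lemma M_nonneg: "0 \<le> M"
  using du_bounded[of 0] by linarith

lemma du_integrable: "du integrable_on {p..q}"
proof (rule measurable_bounded_by_integrable_imp_integrable_real)
  show "du \<in> borel_measurable (lebesgue_on {p..q})"
    using du_measurable by (intro measurable_restrict_space1 measurable_completion) auto
qed (use du_bounded in auto)

lemma abs_du_integrable: "(\<lambda>s. \<bar>du s\<bar>) integrable_on {p..q}"
proof -
  have "du absolutely_integrable_on {p..q}"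
    by (rule absolutely_integrable_integrable_bound[of _ _ "\<lambda>_. M"])
      (use du_bounded du_integrable in auto)
  then show ?thesis by (simp add: absolutely_integrable_on_def)
qed

lemma var_0 [simp]: "var 0 = 0"
  by (simp add: var_def)

lemma var_diff:
  assumes "0 \<le> s" "s \<le> t"
  shows "var t - var s = integral {s..t} (\<lambda>s. \<bar>du s\<bar>)"
  unfolding var_def by (rule integral_diff_initial[OF abs_du_integrable assms order_refl])

lemma var_increment:
  assumes "0 \<le> s" "s \<le> t"
  shows "var s \<le> var t" "var t - var s \<le> M * (t - s)"
proof -
  have "0 \<le> integral {s..t} (\<lambda>s. \<bar>du s\<bar>)"
    by (intro integral_nonneg abs_du_integrable) auto
  moreover have "\<bar>integral {s..t} (\<lambda>s. \<bar>du s\<bar>)\<bar> \<le> M * (t - s)"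
    by (rule abs_integral_le_interval) (use assms du_bounded abs_du_integrable in auto)
  ultimately show "var s \<le> var t" "var t - var s \<le> M * (t - s)"
    using var_diff[OF assms] by linarith+
qed

lemma var_continuous: "0 \<le> p \<Longrightarrow> continuous_on {p..q} var"
  using var_increment by (intro lipschitz_imp_continuous_on_interval[of _ _ _ M]) force

text \<open>Here \<open>\<epsilon>\<close> is the direction of monotonicity. The signs of the
  integrals over all subintervals are what \<open>integral_abs_eq_integral\<close> asks for, so no
  pointwise sign of \<open>du\<close> enters.\<close>

lemma var_eq_abs_increment:
  assumes "0 \<le> p" "p \<le> q" and \<epsilon>: "\<epsilon> = 1 \<or> \<epsilon> = -1"
    and "\<And>s t. \<lbrakk>p \<le> s; s \<le> t; t \<le> q\<rbrakk> \<Longrightarrow> 0 \<le> \<epsilon> * integral {s..t} du"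
  shows "var q - var p = \<epsilon> * integral {p..q} du"
proof -
  have "integral {p..q} (\<lambda>x. \<bar>\<epsilon> * du x\<bar>) = integral {p..q} (\<lambda>x. \<epsilon> * du x)"
  proof (rule integral_abs_eq_integral[OF assms(2)])
    show "(\<lambda>x. \<epsilon> * du x) integrable_on {p..q}"
      by (intro integrable_on_mult_right du_integrable)
    show "(\<lambda>x. \<bar>\<epsilon> * du x\<bar>) integrable_on {p..q}"
      unfolding abs_mult by (intro integrable_on_mult_right abs_du_integrable)
  qed (use assms(4) in simp)
  then show ?thesis
    using \<epsilon> var_diff[OF assms(1,2)] by auto
qed

context
  fixes a :: real
  assumes a_pos: "0 < a"
begin

text \<open>The chain rule \<open>d exp (a v) = a exp (a v) dv\<close> in second-order form: the
  first estimate makes \<open>exp (a * var t)\<close> a Lipschitz weight, the second makes it a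
  primitive for \<open>integral_weighted_eq_increment\<close>.\<close>

lemma exp_var_increment:
  assumes "0 \<le> s" "s \<le> t" "t \<le> q"
  shows "\<bar>exp (a * var t) - exp (a * var s)\<bar> \<le> a * M * exp (a * var q) * (t - s)"
    and "\<bar>exp (a * var t) - exp (a * var s) - a * exp (a * var s) * (var t - var s)\<bar>
           \<le> (a * M)\<^sup>2 * exp (a * var q) * (t - s)\<^sup>2"
proof -
  define x where "x = a * (var t - var s)"
  note inc = var_increment[OF assms(1,2)]
  have x: "0 \<le> x" "x \<le> a * M * (t - s)"
    using inc a_pos by (auto simp: x_def mult.assoc)
  have et: "exp (a * var t) = exp (a * var s) * exp x"
    by (simp add: x_def algebra_simps flip: exp_add)
  have etq: "exp (a * var t) \<le> exp (a * var q)"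
    using var_increment(1)[of t q] assms a_pos by simp
  have "\<bar>exp (a * var t) - exp (a * var s)\<bar> = exp (a * var s) * (exp x - 1)"
    using x by (simp add: et right_diff_distrib)
  also have "\<dots> \<le> exp (a * var s) * (x * exp x)"
    by (intro mult_left_mono exp_minus_one_bound x) simp
  also have "\<dots> = x * exp (a * var t)" by (simp add: et)
  also have "\<dots> \<le> (a * M * (t - s)) * exp (a * var q)"
    using x etq by (intro mult_mono) auto
  finally show "\<bar>exp (a * var t) - exp (a * var s)\<bar> \<le> a * M * exp (a * var q) * (t - s)"
    by (simp add: mult_ac)
  have "exp (a * var t) - exp (a * var s) - a * exp (a * var s) * (var t - var s) =
      exp (a * var s) * (exp x - 1 - x)"
    by (simp add: et algebra_simps) (simp add: x_def algebra_simps)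
  then have "\<bar>exp (a * var t) - exp (a * var s) - a * exp (a * var s) * (var t - var s)\<bar> =
      exp (a * var s) * (exp x - 1 - x)"
    using exp_minus_one_bound(1)[OF x(1)] by simp
  also have "\<dots> \<le> exp (a * var s) * (x\<^sup>2 * exp x)"
    by (intro mult_left_mono exp_minus_one_bound x) simp
  also have "\<dots> = x\<^sup>2 * exp (a * var t)" by (simp add: et)
  also have "\<dots> \<le> (a * M * (t - s))\<^sup>2 * exp (a * var q)"
    using x etq by (intro mult_mono power_mono) auto
  finally show "\<bar>exp (a * var t) - exp (a * var s) - a * exp (a * var s) * (var t - var s)\<bar>
           \<le> (a * M)\<^sup>2 * exp (a * var q) * (t - s)\<^sup>2"
    by (simp add: power_mult_distrib mult_ac)
qed

lemma exp_var_continuous: "0 \<le> p \<Longrightarrow> continuous_on {p..q} (\<lambda>s. exp (a * var s))"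
  by (intro continuous_intros var_continuous)

text \<open>Serves \<open>f = du\<close> on a monotone piece, where \<open>\<epsilon>\<close> is the
  direction, and \<open>f = \<bar>du\<bar>\<close> with \<open>\<epsilon> = 1\<close>.\<close>

lemma integral_exp_var:
  assumes "0 \<le> p" "p \<le> q" and f: "f integrable_on {p..q}" "\<And>x. x \<in> {p..q} \<Longrightarrow> \<bar>f x\<bar> \<le> M"
    and fv: "\<And>s t. \<lbrakk>p \<le> s; s \<le> t; t \<le> q\<rbrakk> \<Longrightarrow> integral {s..t} f = \<epsilon> * (var t - var s)"
  shows "integral {p..q} (\<lambda>s. exp (a * var s) * f s) = \<epsilon> * (exp (a * var q) - exp (a * var p)) / a"
proof -
  have "integral {p..q} (\<lambda>s. exp (a * var s) * f s) =
      \<epsilon> * exp (a * var q) / a - \<epsilon> * exp (a * var p) / a"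
  proof (rule integral_weighted_eq_increment[OF assms(2) f])
    fix s t assume st: "p \<le> s" "s \<le> t" "t \<le> q"
    then show "\<bar>exp (a * var t) - exp (a * var s)\<bar> \<le> a * M * exp (a * var q) * (t - s)"
      using assms by (intro exp_var_increment) auto
    have "\<epsilon> * exp (a * var t) / a - \<epsilon> * exp (a * var s) / a - exp (a * var s) * integral {s..t} f =
        \<epsilon> / a * (exp (a * var t) - exp (a * var s) - a * exp (a * var s) * (var t - var s))"
      unfolding fv[OF st] using a_pos by (simp add: field_simps)
    also have "\<bar>\<dots>\<bar> \<le> \<bar>\<epsilon> / a\<bar> * ((a * M)\<^sup>2 * exp (a * var q) * (t - s)\<^sup>2)"
      unfolding abs_mult using st assms by (intro mult_left_mono exp_var_increment) auto
    finally show "\<bar>\<epsilon> * exp (a * var t) / a - \<epsilon> * exp (a * var s) / a - exp (a * var s) * integral {s..t} f\<bar>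
        \<le> (\<bar>\<epsilon> / a\<bar> * (a * M)\<^sup>2 * exp (a * var q)) * (t - s)\<^sup>2"
      by (simp add: mult_ac)
  qed
  then show ?thesis by (simp add: diff_divide_distrib right_diff_distrib)
qed

section \<open>Variation of constants\<close>

definition limit_state :: "real \<Rightarrow> real \<Rightarrow> real" where
  "limit_state x0 t = exp (- a * var t) * (x0 + integral {0..t} (\<lambda>s. exp (a * var s) * du s))"

lemma exp_var_du_integrable: "0 \<le> p \<Longrightarrow> (\<lambda>s. exp (a * var s) * du s) integrable_on {p..q}"
  by (rule integrable_continuous_mult_bounded[OF exp_var_continuous du_integrable du_bounded])

text \<open>On a monotone piece the integral in \<open>limit_state\<close> is elementary by
  \<open>integral_exp_var\<close>; this puts the state into the form of \<open>lg_seg\<close>, with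
  amplitude \<open>1 / a\<close> in place of \<open>G\<close>.\<close>

lemma limit_state_step:
  assumes "0 \<le> p" "p \<le> q" and \<epsilon>: "\<epsilon> = 1 \<or> \<epsilon> = -1"
    and mono: "\<And>s t. \<lbrakk>p \<le> s; s \<le> t; t \<le> q\<rbrakk> \<Longrightarrow> 0 \<le> \<epsilon> * integral {s..t} du"
  shows "limit_state x0 q = exp (- a * (var q - var p)) *
           (limit_state x0 p + \<epsilon> / a * (exp (a * (var q - var p)) - 1))"
proof -
  have v: "integral {s..t} du = \<epsilon> * (var t - var s)" if "p \<le> s" "s \<le> t" "t \<le> q" for s t
    using var_eq_abs_increment[of s t \<epsilon>] mono that assms(1) \<epsilon> by force
  have "integral {0..q} (\<lambda>s. exp (a * var s) * du s) - integral {0..p} (\<lambda>s. exp (a * var s) * du s) =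
      \<epsilon> * (exp (a * var q) - exp (a * var p)) / a"
    using integral_diff_initial[OF exp_var_du_integrable assms(1,2) order_refl]
      integral_exp_var[OF assms(1,2) du_integrable du_bounded v] by simp
  then have I: "integral {0..q} (\<lambda>s. exp (a * var s) * du s) =
      integral {0..p} (\<lambda>s. exp (a * var s) * du s) + \<epsilon> * (exp (a * var q) - exp (a * var p)) / a"
    by simp
  have e: "exp (- a * (var q - var p)) = exp (- a * var q) * exp (a * var p)"
    "exp (a * (var q - var p)) = exp (a * var q) * exp (- a * var p)"
    "exp (a * var p) * exp (- a * var p) = 1"
    by (simp_all add: algebra_simps flip: exp_add)
  have "exp (a * var p) * limit_state x0 p = x0 + integral {0..p} (\<lambda>s. exp (a * var s) * du s)"
    unfolding limit_state_def using e(3) by (simp add: mult.assoc[symmetric])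
  moreover have "exp (a * var p) * (\<epsilon> / a * (exp (a * (var q - var p)) - 1)) =
      \<epsilon> * (exp (a * var q) - exp (a * var p)) / a"
    unfolding e(2) using e(3) by (simp add: algebra_simps diff_divide_distrib)
  ultimately have "exp (a * var p) * (limit_state x0 p + \<epsilon> / a * (exp (a * (var q - var p)) - 1)) =
     x0 + integral {0..q} (\<lambda>s. exp (a * var s) * du s)"
    unfolding I distrib_left by simp
  then show ?thesis
    unfolding e(1) mult.assoc by (simp add: limit_state_def)
qed

text \<open>As \<open>var\<close> is nondecreasing, the integrating factor is largest at
  \<open>t\<close>, where \<open>exp (- a * var t)\<close> cancels it; hence the bound is linear in
  \<open>t\<close>.\<close>

lemma limit_state_bound:
  assumes "0 \<le> t"
  shows "\<bar>limit_state x0 t\<bar> \<le> \<bar>x0\<bar> + M * t"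
proof -
  have "\<bar>integral {0..t} (\<lambda>s. exp (a * var s) * du s)\<bar> \<le> (exp (a * var t) * M) * (t - 0)"
  proof (rule abs_integral_le_interval[OF assms exp_var_du_integrable])
    fix s assume "s \<in> {0..t}"
    then show "\<bar>exp (a * var s) * du s\<bar> \<le> exp (a * var t) * M"
      unfolding abs_mult using var_increment(1)[of s t] a_pos du_bounded by (intro mult_mono) auto
  qed simp
  then have "exp (- a * var t) * \<bar>x0 + integral {0..t} (\<lambda>s. exp (a * var s) * du s)\<bar>
      \<le> exp (- a * var t) * (\<bar>x0\<bar> + exp (a * var t) * M * t)"
    by (intro mult_left_mono) auto
  also have "\<dots> = exp (- a * var t) * \<bar>x0\<bar> + M * t"
    by (simp add: algebra_simps flip: exp_add)
  also have "\<dots> \<le> 1 * \<bar>x0\<bar> + M * t"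
    using var_increment(1)[of 0 t] assms a_pos by (intro add_right_mono mult_right_mono) auto
  finally show ?thesis
    by (simp add: limit_state_def abs_mult)
qed

text \<open>After multiplication by the integrating factor of the limit equation, \<open>z\<close>
  and \<open>limit_state\<close> share the input term, and only the coefficient error
  \<open>(a - b s) * \<bar>du s\<bar> * z s\<close> remains under the integral. Its weight is
  largest at \<open>X\<close> and divides out at the end.\<close>

lemma solution_minus_limit_state:
  assumes X: "0 \<le> X"
    and b: "\<And>s. \<bar>a - b s\<bar> \<le> \<delta>"
    and rhs: "rhs = (\<lambda>s. - b s * \<bar>du s\<bar> * z s + du s)"
    and int: "rhs integrable_on {0..X}"
    and z: "\<And>t. t \<in> {0..X} \<Longrightarrow> z t = x0 + integral {0..t} rhs"
    and m: "\<And>t. t \<in> {0..X} \<Longrightarrow> \<bar>z t\<bar> \<le> m"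
  shows "\<bar>z X - limit_state x0 X\<bar> \<le> \<delta> * M * m * X"
proof -
  define e where "e s = exp (a * var s)" for s
  have m0: "0 \<le> m" and \<delta>: "0 \<le> \<delta>" using m[of 0] b[of 0] X by force+
  have z0: "z 0 = x0" using z[of 0] X by simp
  have cont_z: "continuous_on {0..X} z"
    using indefinite_integral_continuous_1[OF int] z
    by (subst continuous_on_cong[OF refl, of _ _ "\<lambda>t. x0 + integral {0..t} rhs"])
      (auto intro!: continuous_intros)
  have cont_e: "continuous_on {0..X} e"
    unfolding e_def by (rule exp_var_continuous) simp
  have e_le: "e s \<le> e X" "0 < e s" if "s \<in> {0..X}" for s
    using var_increment(1)[of s X] that a_pos by (auto simp: e_def)
  have rhs_bd: "\<bar>rhs s\<bar> \<le> (a + \<delta>) * M * m + M" if "s \<in> {0..X}" for s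
  proof -
    have "\<bar>b s\<bar> \<le> a + \<delta>" using b[of s] a_pos by linarith
    then have "\<bar>- b s * \<bar>du s\<bar> * z s\<bar> \<le> (a + \<delta>) * M * m"
      unfolding abs_mult using du_bounded[of s] m[OF that] m0 M_nonneg by (auto intro!: mult_mono)
    then show ?thesis using du_bounded[of s] by (auto simp: rhs)
  qed
  have ae: "(\<lambda>s. a * e s * \<bar>du s\<bar>) integrable_on {0..X}"
    by (rule integrable_continuous_mult_bounded[OF _ abs_du_integrable, of _ _ _ M])
      (auto intro!: continuous_intros cont_e simp: du_bounded)
  have ae_bd: "\<bar>a * e t * \<bar>du t\<bar>\<bar> \<le> a * e X * M" if t: "t \<in> {0..X}" for t
    unfolding abs_mult using a_pos e_le[OF t] du_bounded[of t] M_nonneg by (intro mult_mono) auto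
  \<comment> \<open>The product rule applies because \<open>e\<close> is, up to its initial value,
    the indefinite integral of \<open>a * e s * \<bar>du s\<bar>\<close>.\<close>
  have "e X * z X - e 0 * z 0 = integral {0..X} (\<lambda>s. e s * rhs s + z s * (a * e s * \<bar>du s\<bar>))"
  proof (rule integral_product_rule[OF X ae ae_bd int rhs_bd])
    fix t assume t: "t \<in> {0..X}"
    have "integral {0..t} (\<lambda>s. exp (a * var s) * \<bar>du s\<bar>) = 1 * (exp (a * var t) - exp (a * var 0)) / a"
      by (rule integral_exp_var) (use t du_bounded abs_du_integrable var_diff in auto)
    moreover have "integral {0..t} (\<lambda>s. a * e s * \<bar>du s\<bar>) = a * integral {0..t} (\<lambda>s. e s * \<bar>du s\<bar>)"
      by (simp add: mult.assoc)
    ultimately show "e t = e 0 + integral {0..t} (\<lambda>s. a * e s * \<bar>du s\<bar>)"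
      using a_pos by (simp add: e_def)
    show "z t = z 0 + integral {0..t} rhs" using z[OF t] z0 by simp
  qed
  moreover have "(\<lambda>s. e s * rhs s) integrable_on {0..X}"
    by (rule integrable_continuous_mult_bounded[OF cont_e int rhs_bd])
  moreover have "(\<lambda>s. z s * (a * e s * \<bar>du s\<bar>)) integrable_on {0..X}"
    by (rule integrable_continuous_mult_bounded[OF cont_z ae ae_bd])
  moreover have "(\<lambda>s. e s * du s) integrable_on {0..X}"
    unfolding e_def by (rule exp_var_du_integrable) simp
  ultimately have I: "(\<lambda>s. e s * rhs s + z s * (a * e s * \<bar>du s\<bar>) - e s * du s) integrable_on {0..X}"
    and "e X * z X - x0 - integral {0..X} (\<lambda>s. e s * du s) =
      integral {0..X} (\<lambda>s. e s * rhs s + z s * (a * e s * \<bar>du s\<bar>) - e s * du s)"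
    by (auto intro!: integrable_diff integrable_add
        simp: Henstock_Kurzweil_Integration.integral_diff integrable_add z0 e_def)
  moreover have eq: "e s * rhs s + z s * (a * e s * \<bar>du s\<bar>) - e s * du s = e s * ((a - b s) * \<bar>du s\<bar> * z s)" for s
    by (simp add: rhs algebra_simps)
  ultimately have main: "e X * z X - x0 - integral {0..X} (\<lambda>s. e s * du s) =
      integral {0..X} (\<lambda>s. e s * ((a - b s) * \<bar>du s\<bar> * z s))"
    by simp
  have "\<bar>integral {0..X} (\<lambda>s. e s * ((a - b s) * \<bar>du s\<bar> * z s))\<bar> \<le> (e X * (\<delta> * M * m)) * (X - 0)"
  proof (rule abs_integral_le_interval[OF X])
    \<comment> \<open>Integrability is read off from \<open>I\<close> through \<open>eq\<close>,
      because nothing is known about the measurability of \<open>b\<close>.\<close>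
    show "(\<lambda>s. e s * ((a - b s) * \<bar>du s\<bar> * z s)) integrable_on {0..X}"
      using I unfolding eq .
    fix s assume s: "s \<in> {0..X}"
    have "\<bar>(a - b s) * \<bar>du s\<bar> * z s\<bar> \<le> \<delta> * M * m"
      unfolding abs_mult using b[of s] du_bounded[of s] m[OF s] m0 M_nonneg \<delta> by (auto intro!: mult_mono)
    then show "\<bar>e s * ((a - b s) * \<bar>du s\<bar> * z s)\<bar> \<le> e X * (\<delta> * M * m)"
      unfolding abs_mult[of "e s"] using e_le[OF s] e_le[of X] X by (intro mult_mono) auto
  qed
  moreover have "e X * limit_state x0 X = x0 + integral {0..X} (\<lambda>s. e s * du s)"
    by (simp add: limit_state_def e_def flip: exp_add mult.assoc)
  ultimately have "\<bar>e X * (z X - limit_state x0 X)\<bar> \<le> e X * (\<delta> * M * m * X)"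
    using main by (simp add: right_diff_distrib mult_ac)
  then show ?thesis
    using e_le[of X] X by (simp add: abs_mult)
qed

text \<open>
  Evaluating the previous estimate where \<open>\<bar>z\<bar>\<close> is maximal bounds that maximum independently of the
  coefficient \<open>b\<close>.
\<close>

lemma solution_near_limit_state:
  assumes X: "0 \<le> X"
    and b: "\<And>s. \<bar>a - b s\<bar> \<le> \<delta>"
    and rhs: "rhs = (\<lambda>s. - b s * \<bar>du s\<bar> * z s + du s)"
    and int: "rhs integrable_on {0..X}"
    and z: "\<And>t. t \<in> {0..X} \<Longrightarrow> z t = x0 + integral {0..t} rhs"
    and small: "\<delta> * M * X \<le> 1 / 2"
  shows "\<bar>z X - limit_state x0 X\<bar> \<le> 2 * \<delta> * M * X * (\<bar>x0\<bar> + M * X)"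
proof -
  have \<delta>: "0 \<le> \<delta>" using b[of 0] by linarith
  have "continuous_on {0..X} z"
    using indefinite_integral_continuous_1[OF int] z
    by (subst continuous_on_cong[OF refl, of _ _ "\<lambda>t. x0 + integral {0..t} rhs"])
      (auto intro!: continuous_intros)
  then obtain t where t: "t \<in> {0..X}" and max: "\<And>s. s \<in> {0..X} \<Longrightarrow> \<bar>z s\<bar> \<le> \<bar>z t\<bar>"
    using continuous_attains_sup[of "{0..X}" "\<lambda>t. \<bar>z t\<bar>"] X
    by (force intro: continuous_intros)
  have near: "\<bar>z s - limit_state x0 s\<bar> \<le> \<delta> * M * \<bar>z t\<bar> * s" if s: "s \<in> {0..X}" for s
    by (rule solution_minus_limit_state[OF _ b rhs integrable_subinterval_real[OF int] z])
      (use s max in auto)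
  \<comment> \<open>By \<open>small\<close> the error at the maximum point is at most half the
    maximum and can be absorbed: \<open>\<bar>z t\<bar>\<close> is at most twice the bound on the
    limit state.\<close>
  have "\<delta> * M * \<bar>z t\<bar> * t \<le> \<delta> * M * \<bar>z t\<bar> * X"
    using t \<delta> M_nonneg by (intro mult_left_mono) auto
  also have "\<dots> = (\<delta> * M * X) * \<bar>z t\<bar>" by simp
  also have "\<dots> \<le> 1 / 2 * \<bar>z t\<bar>" by (intro mult_right_mono small) simp
  finally have "\<bar>z t - limit_state x0 t\<bar> \<le> \<bar>z t\<bar> / 2" using near[OF t] by simp
  moreover have "\<bar>limit_state x0 t\<bar> \<le> \<bar>x0\<bar> + M * X"
    using limit_state_bound[of t x0] mult_left_mono[of t X M] t M_nonneg by auto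
  moreover have "\<bar>z t\<bar> \<le> \<bar>z t - limit_state x0 t\<bar> + \<bar>limit_state x0 t\<bar>" by simp
  ultimately have zt: "\<bar>z t\<bar> \<le> 2 * (\<bar>x0\<bar> + M * X)" by argo
  have "(\<delta> * M * X) * \<bar>z t\<bar> \<le> (\<delta> * M * X) * (2 * (\<bar>x0\<bar> + M * X))"
    using zt \<delta> M_nonneg X by (intro mult_left_mono) auto
  then show "\<bar>z X - limit_state x0 X\<bar> \<le> 2 * \<delta> * M * X * (\<bar>x0\<bar> + M * X)"
    using near[of X] X by (simp add: mult_ac)
qed

text \<open>Here \<open>\<tau>\<close> is the start of a period and \<open>tt\<close> lists its
  turning times. On segment \<open>i\<close> the scaled state and \<open>lg_seg\<close> obey the
  same affine step with amplitude \<open>\<sigma> / a\<close>, so their difference, whatever it is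
  at \<open>\<tau>\<close>, is only damped by the exponential of the variation.\<close>

lemma limit_state_minus_loop:
  fixes tt r :: "nat \<Rightarrow> real"
  assumes \<tau>: "0 \<le> \<tau>" and start: "tt 0 = 0" "r 0 = 0"
    and ordered: "\<And>i. i < n \<Longrightarrow> tt i \<le> tt (Suc i)"
    and mono: "\<And>i s t. \<lbrakk>i < n; tt i \<le> s; s \<le> t; t \<le> tt (Suc i)\<rbrakk>
                 \<Longrightarrow> 0 \<le> (-1) ^ i * integral {\<tau> + s..\<tau> + t} du"
    and length: "\<And>i. i < n \<Longrightarrow> (-1) ^ i * integral {\<tau> + tt i..\<tau> + tt (Suc i)} du = r (Suc i) - r i"
  shows "\<lbrakk>i < n; tt i \<le> t; t \<le> tt (Suc i)\<rbrakk> \<Longrightarrow>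
      var (\<tau> + t) - var \<tau> = r i + (-1) ^ i * integral {\<tau> + tt i..\<tau> + t} du" (is "PROP ?V i t")
    and "\<lbrakk>i < n; tt i \<le> t; t \<le> tt (Suc i)\<rbrakk> \<Longrightarrow>
      \<sigma> * limit_state x0 (\<tau> + t) - lg_seg a (\<sigma> / a) r i (var (\<tau> + t) - var \<tau>) =
        exp (- a * (var (\<tau> + t) - var \<tau>)) * (\<sigma> * limit_state x0 \<tau> - lg_node a (\<sigma> / a) r 0)"
        (is "PROP ?L i t")
proof -
  have tt0: "0 \<le> tt i" if "i \<le> n" for i
    using that
  proof (induction i)
    case (Suc i)
    then show ?case using ordered[of i] by simp
  qed (simp add: start)
  \<comment> \<open>The claim inside a segment is first derived from the value at its left node.
    Taken at the right node it drives the induction over the nodes, which then discharges the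
    condition. The same pattern proves \<open>L\<close>.\<close>
  have V: "PROP ?V i t" if node: "var (\<tau> + tt i) - var \<tau> = r i" for i t
  proof -
    assume *: "i < n" "tt i \<le> t" "t \<le> tt (Suc i)"
    have "var (\<tau> + t) - var (\<tau> + tt i) = (-1) ^ i * integral {\<tau> + tt i..\<tau> + t} du"
    proof (rule var_eq_abs_increment)
      fix s s' assume "\<tau> + tt i \<le> s" "s \<le> s'" "s' \<le> \<tau> + t"
      then show "0 \<le> (-1) ^ i * integral {s..s'} du"
        using mono[of i "s - \<tau>" "s' - \<tau>"] * by simp
    qed (use \<tau> tt0[of i] * in \<open>auto simp: minus_one_power_iff\<close>)
    with node show "var (\<tau> + t) - var \<tau> = r i + (-1) ^ i * integral {\<tau> + tt i..\<tau> + t} du" by simp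
  qed
  have node: "var (\<tau> + tt i) - var \<tau> = r i" if "i \<le> n" for i
    using that
  proof (induction i)
    case (Suc i)
    then show ?case using V[of i "tt (Suc i)"] ordered[of i] length[of i] by simp
  qed (simp add: start)
  show "PROP ?V i t" by (rule V) (simp_all add: node)
  have L: "PROP ?L i t"
    if nodeL: "\<sigma> * limit_state x0 (\<tau> + tt i) - lg_node a (\<sigma> / a) r i =
        exp (- a * r i) * (\<sigma> * limit_state x0 \<tau> - lg_node a (\<sigma> / a) r 0)" for i t
  proof -
    assume *: "i < n" "tt i \<le> t" "t \<le> tt (Suc i)"
    define x where "x = var (\<tau> + t) - var \<tau>"
    have x: "var (\<tau> + t) - var (\<tau> + tt i) = x - r i"
      using node[of i] * by (simp add: x_def)
    have step: "limit_state x0 (\<tau> + t) = exp (- a * (var (\<tau> + t) - var (\<tau> + tt i))) *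
           (limit_state x0 (\<tau> + tt i) + (-1) ^ i / a * (exp (a * (var (\<tau> + t) - var (\<tau> + tt i))) - 1))"
    proof (rule limit_state_step)
      fix s s' assume "\<tau> + tt i \<le> s" "s \<le> s'" "s' \<le> \<tau> + t"
      then show "0 \<le> (-1) ^ i * integral {s..s'} du"
        using mono[of i "s - \<tau>" "s' - \<tau>"] * by simp
    qed (use \<tau> tt0[of i] * in \<open>auto simp: minus_one_power_iff\<close>)
    have "\<sigma> * limit_state x0 (\<tau> + t) - lg_seg a (\<sigma> / a) r i x =
        exp (- a * (x - r i)) * (\<sigma> * limit_state x0 (\<tau> + tt i) - lg_node a (\<sigma> / a) r i)"
      unfolding step x lg_seg_def by (simp add: algebra_simps)
    also have "\<dots> = (exp (- a * (x - r i)) * exp (- a * r i)) *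
        (\<sigma> * limit_state x0 \<tau> - lg_node a (\<sigma> / a) r 0)"
      unfolding nodeL by simp
    also have "exp (- a * (x - r i)) * exp (- a * r i) = exp (- a * x)"
      by (simp add: algebra_simps flip: exp_add)
    finally show "\<sigma> * limit_state x0 (\<tau> + t) - lg_seg a (\<sigma> / a) r i (var (\<tau> + t) - var \<tau>) =
        exp (- a * (var (\<tau> + t) - var \<tau>)) * (\<sigma> * limit_state x0 \<tau> - lg_node a (\<sigma> / a) r 0)"
      unfolding x_def .
  qed
  have nodeL: "\<sigma> * limit_state x0 (\<tau> + tt i) - lg_node a (\<sigma> / a) r i =
        exp (- a * r i) * (\<sigma> * limit_state x0 \<tau> - lg_node a (\<sigma> / a) r 0)" if "i \<le> n" for i
    using that
  proof (induction i)
    case (Suc i)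
    then show ?case using L[of i "tt (Suc i)"] ordered[of i] node[of "Suc i"]
      by (simp add: lg_node_Suc_eq_seg del: lg_node.simps)
  qed (simp add: start del: lg_node.simps)
  show "PROP ?L i t" by (rule L) (simp_all add: nodeL del: lg_node.simps)
qed

end

end

section \<open>Identification of the loop\<close>

text \<open>The exceptional set need not be Borel, so the proof passes to the completion, where
  subsets of null sets are null sets.\<close>

lemma AE_lborel_iff_negligible:
  "(AE x in lborel. P (x :: real)) \<longleftrightarrow> negligible {x. \<not> P x}"
proof -
  have "(AE x in lborel. P x) \<longleftrightarrow> (AE x in lebesgue. P x)"
    by (simp add: AE_completion_iff)
  also have "\<dots> \<longleftrightarrow> {x. \<not> P x} \<in> null_sets lebesgue"
  proof
    assume "AE x in lebesgue. P x"
    then obtain N where "N \<in> null_sets lebesgue" "{x. \<not> P x} \<subseteq> N"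
      by (auto simp: eventually_ae_filter)
    then show "{x. \<not> P x} \<in> null_sets lebesgue"
      by (metis negligible_iff_null_sets negligible_subset)
  qed (auto intro: AE_I')
  finally show ?thesis by (simp add: negligible_iff_null_sets)
qed

lemma AE_lborel_translation:
  assumes "AE x in lborel. P (x :: real)"
  shows "AE x in lborel. P (x + c)"
proof -
  have "negligible ((+) (- c) ` {x. \<not> P x})"
    using assms unfolding AE_lborel_iff_negligible by (rule negligible_translation)
  moreover have "{x. \<not> P (x + c)} = (+) (- c) ` {x. \<not> P x}"
    by (auto simp: image_iff) (metis add_diff_cancel_right')
  ultimately show ?thesis by (simp add: AE_lborel_iff_negligible)
qed

text \<open>The points of disagreement in the open interval form an open negligible set, so there
  are none; the end points follow by continuity.\<close>

lemma continuous_AE_eq_imp_eq: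
  fixes f h :: "real \<Rightarrow> real"
  assumes ab: "a < b" and f: "continuous_on {a..b} f" and h: "continuous_on {a..b} h"
    and eq: "AE x in lborel. x \<in> {a..b} \<longrightarrow> f x = h x" and x: "x \<in> {a..b}"
  shows "f x = h x"
proof -
  have fh: "continuous_on {a..b} (\<lambda>x. f x - h x)"
    by (intro continuous_intros f h)
  have "open ({a<..<b} \<inter> (\<lambda>x. f x - h x) -` (- {0}))"
    by (rule continuous_open_preimage[OF continuous_on_subset[OF fh]]) auto
  moreover have "negligible ({a<..<b} \<inter> (\<lambda>x. f x - h x) -` (- {0}))"
    by (rule negligible_subset[OF eq[unfolded AE_lborel_iff_negligible]]) auto
  ultimately have "{a<..<b} \<inter> (\<lambda>x. f x - h x) -` (- {0}) = {}"
    using open_not_negligible by blast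
  then have z: "f y - h y = 0" if "y \<in> {a<..<b}" for y using that by blast
  have "f x - h x = 0"
    by (rule continuous_constant_on_closure[of "{a<..<b}" "\<lambda>x. f x - h x"])
      (use ab fh z x in auto)
  then show ?thesis by simp
qed

text \<open>Identifies an essentially uniform limit from a pointwise one. The exceptional sets
  depend on the accuracy \<open>1 / real (Suc n)\<close> and on \<open>k\<close>; being countably
  many, they merge into one null set, outside of which the limits are compared point by
  point.\<close>

lemma AE_uniform_limit_unique:
  fixes h :: "nat \<Rightarrow> 'a \<Rightarrow> real"
  assumes unif: "\<And>\<epsilon>. 0 < \<epsilon> \<Longrightarrow> \<exists>K. \<forall>k\<ge>K. AE x in M. P x \<longrightarrow> \<bar>h k x - y x\<bar> \<le> \<epsilon>"
    and lim: "AE x in M. P x \<longrightarrow> (\<lambda>k. h k x) \<longlonglongrightarrow> w x"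
  shows "AE x in M. P x \<longrightarrow> y x = w x"
proof -
  have "\<forall>n. \<exists>K. \<forall>k\<ge>K. AE x in M. P x \<longrightarrow> \<bar>h k x - y x\<bar> \<le> 1 / real (Suc n)"
    using unif by simp
  then obtain K where K: "\<And>n k. k \<ge> K n \<Longrightarrow> AE x in M. P x \<longrightarrow> \<bar>h k x - y x\<bar> \<le> 1 / real (Suc n)"
    by metis
  have "AE x in M. \<forall>n k. k \<ge> K n \<longrightarrow> P x \<longrightarrow> \<bar>h k x - y x\<bar> \<le> 1 / real (Suc n)"
    unfolding AE_all_countable using K by auto
  with lim show ?thesis
  proof eventually_elim
    case (elim x)
    show ?case
    proof
      assume P: "P x"
      then have "(\<lambda>k. \<bar>h k x - y x\<bar>) \<longlonglongrightarrow> \<bar>w x - y x\<bar>"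
        using elim(1) by (intro tendsto_intros) auto
      then have "\<bar>w x - y x\<bar> \<le> 1 / real (Suc n)" for n
        using elim(2) P by (intro LIMSEQ_le_const2) blast+
      moreover have "(\<lambda>n. 1 / real (Suc n)) \<longlonglongrightarrow> 0"
        using LIMSEQ_inverse_real_of_nat by (simp add: inverse_eq_divide)
      ultimately have "\<bar>w x - y x\<bar> \<le> 0"
        by (intro LIMSEQ_le_const) blast+
      then show "y x = w x" by simp
    qed
  qed
qed

section \<open>The breakpoints and the zigzag function\<close>

lemma lg_rho_strict_mono:
  assumes "m1 < M1" "m2 < M1" "m2 < M2" "m1 < M2"
  shows "strict_mono_on {..4} (lg_rho m1 M1 m2 M2)"
proof (rule strict_mono_onI)
  fix i j :: nat assume "i \<in> {..4}" "j \<in> {..4}" "i < j"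
  then show "lg_rho m1 M1 m2 M2 i < lg_rho m1 M1 m2 M2 j"
    using assms by (auto simp: lg_rho_def Let_def)
qed

lemma lg_psi_eq_seg:
  assumes "m1 < M1" "m2 < M1" "m2 < M2" "m1 < M2" and i: "i < 4"
    and x: "lg_rho m1 M1 m2 M2 i \<le> x" "x \<le> lg_rho m1 M1 m2 M2 (Suc i)"
  shows "lg_psi m1 M1 m2 M2 x = [m1, M1, m2, M2] ! i + (-1) ^ i * (x - lg_rho m1 M1 m2 M2 i)"
proof -
  from i have "i = 0 \<or> i = 1 \<or> i = 2 \<or> i = 3" by arith
  then show ?thesis using assms(1-4) x
    by (auto simp: lg_psi_def lg_rho_def Let_def)
qed

section \<open>The limit of slow inputs\<close>

lemma lugre_coefficient_tendsto:
  fixes g du :: "real \<Rightarrow> real"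
  assumes g: "continuous_on UNIV g" "\<And>v. 0 < g v" and M: "\<And>s. \<bar>du s\<bar> \<le> M" and \<delta>: "0 < \<delta>"
  shows "\<forall>\<^sub>F \<gamma> in at_top. \<forall>s. \<bar>\<sigma> / g 0 - \<sigma> / g (du s / \<gamma>)\<bar> \<le> \<delta>"
proof -
  have "continuous_on UNIV (\<lambda>v. \<sigma> / g v)"
    using g by (intro continuous_intros) (auto simp: less_imp_neq[THEN not_sym])
  then have "isCont (\<lambda>v. \<sigma> / g v) 0"
    by (simp add: continuous_on_eq_continuous_at)
  then obtain d where d: "0 < d" "\<And>v. \<bar>v\<bar> < d \<Longrightarrow> \<bar>\<sigma> / g v - \<sigma> / g 0\<bar> < \<delta>"
    using \<delta> by (auto simp: continuous_at_eps_delta dist_real_def)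
  have M0: "0 \<le> M" using M[of 0] by linarith
  have "\<forall>\<^sub>F \<gamma> in at_top. M / d < \<gamma>" by (rule eventually_gt_at_top)
  then show ?thesis
  proof eventually_elim
    case (elim \<gamma>)
    then have \<gamma>: "0 < \<gamma>" using M0 d(1) by (meson divide_nonneg_pos le_less_trans)
    have "\<bar>du s / \<gamma>\<bar> < d" for s
    proof -
      have "\<bar>du s / \<gamma>\<bar> \<le> M / \<gamma>"
        using \<gamma> M[of s] by (simp add: divide_right_mono)
      also have "\<dots> < d" using elim \<gamma> d(1) by (simp add: field_simps)
      finally show ?thesis .
    qed
    then show ?case
      using d(2) abs_minus_commute less_imp_le by metis
  qed
qed

lemma (in bounded_rate) lugre_solution_tendsto:
  fixes g :: "real \<Rightarrow> real"
  assumes \<sigma>0: "0 < \<sigma>0" and g: "continuous_on UNIV g" "\<And>v. 0 < g v" and X: "0 \<le> X"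
    and z: "\<And>\<gamma> t. \<lbrakk>0 < \<gamma>; 0 \<le> t\<rbrakk> \<Longrightarrow> lugre_rhs \<sigma>0 g du \<gamma> (z \<gamma>) integrable_on {0..t} \<and>
                  z \<gamma> t = x0 + integral {0..t} (lugre_rhs \<sigma>0 g du \<gamma> (z \<gamma>))"
  shows "((\<lambda>\<gamma>. z \<gamma> X) \<longlongrightarrow> limit_state (\<sigma>0 / g 0) x0 X) at_top"
proof (rule tendstoI)
  fix e :: real assume e: "0 < e"
  \<comment> \<open>\<open>C\<close> collects the factor of \<open>\<delta>\<close> in
    \<open>solution_near_limit_state\<close>. In \<open>\<delta>\<close>, the first term secures the
    smallness condition and the second makes \<open>\<delta> * C\<close> less than \<open>e\<close>;
    the added ones keep the denominators positive.\<close>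
  define C where "C = 2 * M * X * (\<bar>x0\<bar> + M * X)"
  define \<delta> where "\<delta> = min (1 / (2 * (M * X + 1))) (e / (C + 1))"
  have MX: "0 \<le> M * X" and C: "0 \<le> C" using M_nonneg X by (auto simp: C_def)
  have a: "0 < \<sigma>0 / g 0" using \<sigma>0 g(2) by simp
  have \<delta>: "0 < \<delta>" using e MX C by (auto simp: \<delta>_def)
  have "\<delta> * (M * X) \<le> 1 / (2 * (M * X + 1)) * (M * X)"
    using MX by (intro mult_right_mono) (auto simp: \<delta>_def)
  also have "\<dots> \<le> 1 / 2" using MX by (simp add: field_simps)
  finally have small: "\<delta> * M * X \<le> 1 / 2" by simp
  have "\<delta> * C \<le> e / (C + 1) * C" using C by (intro mult_right_mono) (auto simp: \<delta>_def)
  also have "\<dots> < e" using C e by (simp add: field_simps)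
  finally have \<delta>C: "\<delta> * C < e" .
  show "\<forall>\<^sub>F \<gamma> in at_top. dist (z \<gamma> X) (limit_state (\<sigma>0 / g 0) x0 X) < e"
    using lugre_coefficient_tendsto[where g = g and du = du and \<sigma> = \<sigma>0, OF g du_bounded \<delta>] eventually_gt_at_top[of 0]
  proof eventually_elim
    case (elim \<gamma>)
    have "\<bar>z \<gamma> X - limit_state (\<sigma>0 / g 0) x0 X\<bar> \<le> 2 * \<delta> * M * X * (\<bar>x0\<bar> + M * X)"
    proof (rule solution_near_limit_state[OF a X, of "\<lambda>s. \<sigma>0 / g (du s / \<gamma>)" _
          "lugre_rhs \<sigma>0 g du \<gamma> (z \<gamma>)"])
      show "lugre_rhs \<sigma>0 g du \<gamma> (z \<gamma>) = (\<lambda>s. - (\<sigma>0 / g (du s / \<gamma>)) * \<bar>du s\<bar> * z \<gamma> s + du s)"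
        by (auto simp: lugre_rhs_def)
    qed (use elim z X small in auto)
    also have "\<dots> = \<delta> * C" by (simp add: C_def)
    finally show ?case using \<delta>C by (simp add: dist_real_def)
  qed
qed

text \<open>At a fixed time the right-hand side converges, so the factor
  \<open>\<sigma>1 / \<gamma>\<close> removes it, and \<open>f (du X / \<gamma>)\<close> tends to
  \<open>f 0 = 0\<close>. Pointwise convergence is enough to identify a given uniform limit.\<close>

lemma (in bounded_rate) lugre_out_tendsto:
  fixes g f :: "real \<Rightarrow> real"
  assumes \<sigma>0: "0 < \<sigma>0" and g: "continuous_on UNIV g" "\<And>v. 0 < g v" and X: "0 \<le> X"
    and f: "continuous_on UNIV f" "f 0 = 0"
    and z: "\<And>\<gamma> t. \<lbrakk>0 < \<gamma>; 0 \<le> t\<rbrakk> \<Longrightarrow> lugre_rhs \<sigma>0 g du \<gamma> (z \<gamma>) integrable_on {0..t} \<and>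
                  z \<gamma> t = x0 + integral {0..t} (lugre_rhs \<sigma>0 g du \<gamma> (z \<gamma>))"
  shows "((\<lambda>\<gamma>. lugre_out \<sigma>0 \<sigma>1 g f du \<gamma> (z \<gamma>) X) \<longlongrightarrow> \<sigma>0 * limit_state (\<sigma>0 / g 0) x0 X) at_top"
proof -
  have inv: "((\<lambda>\<gamma>. c / \<gamma>) \<longlongrightarrow> 0) at_top" for c :: real
    by (rule real_tendsto_divide_at_top[OF tendsto_const filterlim_ident])
  have comp: "((\<lambda>\<gamma>. k (du X / \<gamma>)) \<longlongrightarrow> k 0) at_top" if "continuous_on UNIV k" for k :: "real \<Rightarrow> real"
    using that inv by (auto intro: isCont_tendsto_compose simp: continuous_on_eq_continuous_at)
  note zl = lugre_solution_tendsto[OF \<sigma>0 g X z]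
  have "((\<lambda>\<gamma>. lugre_rhs \<sigma>0 g du \<gamma> (z \<gamma>) X) \<longlongrightarrow>
      - \<sigma>0 * \<bar>du X\<bar> / g 0 * limit_state (\<sigma>0 / g 0) x0 X + du X) at_top"
    unfolding lugre_rhs_def using g(2)[of 0] by (intro tendsto_intros comp g zl) auto
  from tendsto_mult[OF inv[of \<sigma>1] this]
  have "((\<lambda>\<gamma>. \<sigma>0 * z \<gamma> X + \<sigma>1 / \<gamma> * lugre_rhs \<sigma>0 g du \<gamma> (z \<gamma>) X + f (du X / \<gamma>)) \<longlongrightarrow>
     \<sigma>0 * limit_state (\<sigma>0 / g 0) x0 X + 0 + 0) at_top"
    using comp[OF f(1)] f(2) by (intro tendsto_intros zl) auto
  then show ?thesis by (simp add: lugre_out_def)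
qed

theorem theoremA:
  fixes \<sigma>0 \<sigma>1 x0 umin1 umin2 umax1 umax2 t1 t2 t3 t4 t5 :: real
    and g f u du :: "real \<Rightarrow> real"
    and z :: "real \<Rightarrow> real \<Rightarrow> real"
    and ystar ycirc :: "real \<Rightarrow> real"
  assumes s0: "\<sigma>0 > 0" and s1: "\<sigma>1 > 0"
    and g_cont: "continuous_on UNIV g" and g_pos: "\<forall>v. g v > 0"
    and f_cont: "continuous_on UNIV f" and f0: "f 0 = 0"
    and ord_u: "umin1 \<le> umin2" "umin2 < umax1" "umax1 \<le> umax2"
    and neq: "umin1 \<noteq> umin2 \<or> umax1 \<noteq> umax2"
    and ord_t: "0 < t1" "t1 < t2" "t2 < t3" "t3 < t4"
    \<comment> \<open>u in W^{1,infinity}(R^+) with weak derivative du\<close>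
    and du_meas: "du \<in> borel_measurable lborel"
    and du_bdd: "\<exists>M. \<forall>t. \<bar>du t\<bar> \<le> M"
    and u_bdd: "\<exists>M. \<forall>t\<ge>0. \<bar>u t\<bar> \<le> M"
    and u_ac: "\<forall>t\<ge>0. u t = u 0 + integral {0..t} du"
    \<comment> \<open>bimodal input\<close>
    and u_per: "\<forall>t\<ge>0. u (t + t4) = u t"
    and u_mono1: "strict_mono_on {0..t1} u"
    and u_mono2: "strict_antimono_on {t1..t2} u"
    and u_mono3: "strict_mono_on {t2..t3} u"
    and u_mono4: "strict_antimono_on {t3..t4} u"
    and u_vals: "u 0 = umin1" "u t1 = umax1" "u t2 = umin2" "u t3 = umax2" "u t4 = u 0"
    \<comment> \<open>Caratheodory solutions z_gamma of the rescaled LuGre state equation\<close>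
    and z_sol: "\<forall>\<gamma>>0. \<forall>t\<ge>0.
                  lugre_rhs \<sigma>0 g du \<gamma> (z \<gamma>) integrable_on {0..t} \<and>
                  z \<gamma> t = x0 + integral {0..t} (lugre_rhs \<sigma>0 g du \<gamma> (z \<gamma>))"
    \<comment> \<open>y_gamma \<rightarrow> ystar in L^infinity(R^+) as gamma \<rightarrow> infinity\<close>
    and ystar_lim: "\<forall>\<epsilon>>0. \<exists>\<Gamma>. \<forall>\<gamma>\<ge>\<Gamma>. \<gamma> > 0 \<longrightarrow>
                  (AE t in lborel. t \<ge> 0 \<longrightarrow>
                     \<bar>lugre_out \<sigma>0 \<sigma>1 g f du \<gamma> (z \<gamma>) t - ystar t\<bar> \<le> \<epsilon>)"
    \<comment> \<open>ystar(. + k T) \<rightarrow> ycirc in L^infinity([0,T]), T = t4\<close>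
    and ycirc_lim: "\<forall>\<epsilon>>0. \<exists>K::nat. \<forall>k\<ge>K.
                  (AE t in lborel. t \<in> {0..t4} \<longrightarrow> \<bar>ystar (t + real k * t4) - ycirc t\<bar> \<le> \<epsilon>)"
    \<comment> \<open>pointwise values are taken for the continuous representative\<close>
    and ycirc_cont: "continuous_on {0..t4} ycirc"
    and t5: "t2 < t5" "t5 \<le> t3" "u t5 = u t1"
  shows "{(u t, ycirc t) | t. t \<in> {0..t4}} =
           {(lg_psi umin1 umax1 umin2 umax2 s,
             lg_y (\<sigma>0 / g 0) (g 0) (lg_rho umin1 umax1 umin2 umax2) s) | s.
              s \<in> {0..lg_rho umin1 umax1 umin2 umax2 4}}
       \<and> {(u t, ycirc t) | t. t \<in> {t1..t5}} =
           {(lg_psi umin1 umax1 umin2 umax2 s,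
             lg_y (\<sigma>0 / g 0) (g 0) (lg_rho umin1 umax1 umin2 umax2) s) | s.
              s \<in> {lg_rho umin1 umax1 umin2 umax2 1 ..
                     umax1 - umin2 + lg_rho umin1 umax1 umin2 umax2 2}}"
proof -
  obtain M where M: "\<And>t. \<bar>du t\<bar> \<le> M" using du_bdd by auto
  interpret bounded_rate du M
    using du_meas M by unfold_locales auto
  define a where "a = \<sigma>0 / g 0"
  have a: "0 < a" using s0 g_pos by (simp add: a_def)
  have G: "\<sigma>0 / a = g 0" using s0 by (simp add: a_def)
  define r where "r = lg_rho umin1 umax1 umin2 umax2"
  define tt where "tt = (\<lambda>i. [0, t1, t2, t3, t4] ! i)"
  \<comment> \<open>\<open>Y\<close> is the limit output, to be identified with
    \<open>ystar\<close>; \<open>P\<close> is the closed-form loop as a function of time, to be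
    identified with \<open>ycirc\<close>.\<close>
  define Y where "Y t = \<sigma>0 * limit_state a x0 t" for t
  define P where "P t = lg_y a (g 0) r (var t)" for t
  have u_strict: "umin1 < umax1" "umin2 < umax1" "umin2 < umax2" "umin1 < umax2"
    using ord_u by auto
  have r_mono: "strict_mono_on {..4} r"
    unfolding r_def by (rule lg_rho_strict_mono[OF u_strict])
  have r0: "r 0 = 0" by (simp add: r_def lg_rho_def)
  have r4: "0 < r 4" using strict_mono_onD[OF r_mono, of 0 4] r0 by simp
  have tt0: "tt 0 = 0" by (simp add: tt_def)
  have cases4: "i = 0 \<or> i = 1 \<or> i = 2 \<or> i = 3" if "i < 4" for i :: nat using that by arith
  have tt_le: "tt i \<le> tt (Suc i)" if "i < 4" for i
    using cases4[OF that] ord_t by (auto simp: tt_def)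
  have tt_nonneg: "0 \<le> tt i" if "i < 4" for i
    using cases4[OF that] ord_t by (auto simp: tt_def)

  \<comment> \<open>The input on its monotone pieces\<close>
  have du_int: "integral {s..t} du = u t - u s" if "0 \<le> s" "s \<le> t" for s t
  proof -
    have "u t = u 0 + integral {0..t} du" "u s = u 0 + integral {0..s} du"
      using u_ac that by (blast intro: order_trans)+
    then show ?thesis
      using integral_diff_initial[OF du_integrable that order_refl] by linarith
  qed
  have u_shift: "u (real k * t4 + t) = u t" if "0 \<le> t" for k t
  proof (induction k)
    case (Suc k)
    have "0 \<le> real k * t4 + t" using that ord_t by simp
    then have "u (real k * t4 + t + t4) = u (real k * t4 + t)" using u_per by blast
    with Suc show ?case by (simp add: algebra_simps)
  qed simp
  have du_shift: "integral {real k * t4 + s..real k * t4 + t} du = u t - u s" if "0 \<le> s" "s \<le> t" for k s t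
    using du_int[of "real k * t4 + s" "real k * t4 + t"] that ord_t u_shift by simp
  have u_piece: "0 \<le> (-1) ^ i * (u t - u s)" if "i < 4" "tt i \<le> s" "s \<le> t" "t \<le> tt (Suc i)" for i s t
  proof -
    from that have "s = t \<or> s < t" by linarith
    then show ?thesis
    proof
      assume "s < t"
      then show ?thesis
        using cases4[OF that(1)] that
          monotone_onD[OF u_mono1, of s t] monotone_onD[OF u_mono2, of s t]
          monotone_onD[OF u_mono3, of s t] monotone_onD[OF u_mono4, of s t]
        by (auto simp: tt_def)
    qed simp
  qed
  have u_tt: "u (tt i) = [umin1, umax1, umin2, umax2] ! i" if "i < 4" for i
    using cases4[OF that] u_vals by (auto simp: tt_def)
  have u_len: "(-1) ^ i * (u (tt (Suc i)) - u (tt i)) = r (Suc i) - r i" if "i < 4" for i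
    using cases4[OF that] u_vals by (auto simp: tt_def r_def lg_rho_def Let_def)
  \<comment> \<open>The increments of \<open>u\<close> are the same in every period, so
    \<open>limit_state_minus_loop\<close> applies with the same \<open>tt\<close> and
    \<open>r\<close> from each start \<open>real k * t4\<close>.\<close>
  have loop: "var (real k * t4 + t) - var (real k * t4) = r i + (-1) ^ i * (u t - u (tt i))"
    "Y (real k * t4 + t) - lg_seg a (g 0) r i (var (real k * t4 + t) - var (real k * t4)) =
      exp (- a * (var (real k * t4 + t) - var (real k * t4))) * (Y (real k * t4) - lg_node a (g 0) r 0)"
    if i: "i < 4" "tt i \<le> t" "t \<le> tt (Suc i)" for i t k
  proof -
    have k: "0 \<le> real k * t4" using ord_t by simp
    have mono: "0 \<le> (-1) ^ i * integral {real k * t4 + s..real k * t4 + t} du"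
      if "i < 4" "tt i \<le> s" "s \<le> t" "t \<le> tt (Suc i)" for i s t
      using du_shift[of s t k] u_piece[OF that] tt_nonneg[of i] that by simp
    have len: "(-1) ^ i * integral {real k * t4 + tt i..real k * t4 + tt (Suc i)} du = r (Suc i) - r i"
      if "i < 4" for i
      using du_shift[of "tt i" "tt (Suc i)" k] u_len[OF that] tt_nonneg[OF that] tt_le[OF that] by simp
    show "var (real k * t4 + t) - var (real k * t4) = r i + (-1) ^ i * (u t - u (tt i))"
      using limit_state_minus_loop(1)[OF a k tt0 r0 tt_le mono len i] du_shift[of "tt i" t k]
        tt_nonneg[OF i(1)] i by simp
    show "Y (real k * t4 + t) - lg_seg a (g 0) r i (var (real k * t4 + t) - var (real k * t4)) =
      exp (- a * (var (real k * t4 + t) - var (real k * t4))) * (Y (real k * t4) - lg_node a (g 0) r 0)"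
      unfolding Y_def
      using limit_state_minus_loop(2)[OF a k tt0 r0 tt_le mono len i, of \<sigma>0 x0] unfolding G .
  qed
  have piece: "\<exists>i<4. tt i \<le> t \<and> t \<le> tt (Suc i)" if "t \<in> {0..t4}" for t
  proof -
    have "t \<le> t1 \<or> (t1 \<le> t \<and> t \<le> t2) \<or> (t2 \<le> t \<and> t \<le> t3) \<or> t3 \<le> t" by linarith
    then show ?thesis
      using that by (elim disjE) (force simp: tt_def intro: exI[of _ 0] exI[of _ 1] exI[of _ 2] exI[of _ 3])+
  qed
  have var_piece: "var t = r i + (-1) ^ i * (u t - u (tt i))" "r i \<le> var t" "var t \<le> r (Suc i)"
    if i: "i < 4" "tt i \<le> t" "t \<le> tt (Suc i)" for i t
  proof -
    show v: "var t = r i + (-1) ^ i * (u t - u (tt i))" using loop(1)[OF i, of 0] by simp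
    have "0 \<le> (-1) ^ i * (u t - u (tt i))" "0 \<le> (-1) ^ i * (u (tt (Suc i)) - u t)"
      using u_piece[of i "tt i" t] u_piece[of i t "tt (Suc i)"] i by simp_all
    then show "r i \<le> var t" "var t \<le> r (Suc i)"
      using v u_len[OF i(1)] by (auto simp: algebra_simps)
  qed
  have var_tt: "var (tt i) = r i" if "i < 4" for i
    using var_piece(1)[of i "tt i"] tt_le that by simp
  have var_t4: "var t4 = r 4"
    using var_piece(1)[of 3 t4] u_len[of 3] tt_le[of 3] by (simp add: tt_def)
  have u_psi: "u t = lg_psi umin1 umax1 umin2 umax2 (var t)" if t: "t \<in> {0..t4}" for t
  proof -
    obtain i where i: "i < 4" "tt i \<le> t" "t \<le> tt (Suc i)" using piece[OF t] by blast
    have "lg_psi umin1 umax1 umin2 umax2 (var t) = u (tt i) + (-1) ^ i * (var t - r i)"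
      using lg_psi_eq_seg[OF u_strict i(1)] var_piece(2,3)[OF i] u_tt[OF i(1)] by (simp add: r_def)
    also have "\<dots> = u t" unfolding var_piece(1)[OF i] by (simp add: minus_one_power_iff)
    finally show ?thesis by simp
  qed

  \<comment> \<open>Convergence of the periods to the closed loop\<close>
  have Y_loop: "Y (real k * t4 + t) - P t = exp (- a * var t) * (Y (real k * t4) - lg_node a (g 0) r 0)"
    if t: "t \<in> {0..t4}" for t k
  proof -
    obtain i where i: "i < 4" "tt i \<le> t" "t \<le> tt (Suc i)" using piece[OF t] by blast
    \<comment> \<open>The variation since the start of a period does not depend on \<open>k\<close>,
      so all periods are compared with the same \<open>P\<close>.\<close>
    have v: "var (real k * t4 + t) - var (real k * t4) = var t"
      using loop(1)[OF i] var_piece(1)[OF i] by simp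
    show ?thesis
      using loop(2)[OF i, of k] lg_y_eq_seg[OF r_mono i(1) var_piece(2,3)[OF i]]
      unfolding v P_def by simp
  qed
  \<comment> \<open>The loop ends where it starts, so the discrepancy at the end of one period is
    the initial discrepancy of the next; this gives the geometric decay in
    \<open>Y_node\<close>.\<close>
  have P_t4: "P t4 = lg_node a (g 0) r 0"
  proof -
    have "lg_y a (g 0) r (r 4) = lg_seg a (g 0) r 3 (r (Suc 3))"
      using lg_y_eq_seg[OF r_mono, of 3 "r 4"] strict_mono_onD[OF r_mono, of 3 4] by simp
    also have "\<dots> = lg_node a (g 0) r (Suc 3)" by (rule lg_node_Suc_eq_seg[symmetric])
    also have "Suc 3 = 4" by simp
    also have "lg_node a (g 0) r 4 = lg_node a (g 0) r 0" by (rule lg_node_4) (use a r4 r0 in simp_all)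
    finally show ?thesis by (simp add: P_def var_t4)
  qed
  have Y_node: "Y (real k * t4) - lg_node a (g 0) r 0 = exp (- a * r 4) ^ k * (Y 0 - lg_node a (g 0) r 0)" for k
  proof (induction k)
    case (Suc k)
    have "Y (real (Suc k) * t4) - lg_node a (g 0) r 0 =
        exp (- a * r 4) * (Y (real k * t4) - lg_node a (g 0) r 0)"
      using Y_loop[of t4 k] ord_t by (simp add: P_t4 var_t4 algebra_simps del: lg_node.simps)
    then show ?case by (simp add: Suc del: lg_node.simps)
  qed (simp del: lg_node.simps)
  have Y_lim: "(\<lambda>k. Y (t + real k * t4)) \<longlonglongrightarrow> P t" if t: "t \<in> {0..t4}" for t
  proof -
    have "(\<lambda>k. P t + exp (- a * var t) * (exp (- a * r 4) ^ k * (Y 0 - lg_node a (g 0) r 0)))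
        \<longlonglongrightarrow> P t + exp (- a * var t) * (0 * (Y 0 - lg_node a (g 0) r 0))"
      by (intro tendsto_intros LIMSEQ_realpow_zero) (use a r4 in auto)
    moreover have "Y (t + real k * t4) =
        P t + exp (- a * var t) * (exp (- a * r 4) ^ k * (Y 0 - lg_node a (g 0) r 0))" for k
      using Y_loop[OF t, of k] Y_node[of k] by (simp add: add.commute del: lg_node.simps)
    ultimately show ?thesis by (simp del: lg_node.simps)
  qed

  \<comment> \<open>Identification of the two essential limits\<close>
  have ystar: "AE t in lborel. t \<ge> 0 \<longrightarrow> ystar t = Y t"
  proof (rule AE_uniform_limit_unique)
    fix \<epsilon> :: real assume "0 < \<epsilon>"
    with ystar_lim obtain \<Gamma> where \<Gamma>: "\<And>\<gamma>. \<lbrakk>\<Gamma> \<le> \<gamma>; 0 < \<gamma>\<rbrakk> \<Longrightarrow> AE t in lborel. t \<ge> 0 \<longrightarrow>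
        \<bar>lugre_out \<sigma>0 \<sigma>1 g f du \<gamma> (z \<gamma>) t - ystar t\<bar> \<le> \<epsilon>" by blast
    \<comment> \<open>The parameters run through \<open>real (Suc k)\<close>, which is positive from
      the first index on.\<close>
    obtain K where "\<Gamma> \<le> real K" using real_arch_simple by blast
    then show "\<exists>K. \<forall>k\<ge>K. AE t in lborel. t \<ge> 0 \<longrightarrow>
        \<bar>lugre_out \<sigma>0 \<sigma>1 g f du (real (Suc k)) (z (real (Suc k))) t - ystar t\<bar> \<le> \<epsilon>"
      by (intro exI[of _ K] allI impI \<Gamma>) auto
  next
    have "(\<lambda>k. lugre_out \<sigma>0 \<sigma>1 g f du (real (Suc k)) (z (real (Suc k))) t) \<longlonglongrightarrow> Y t" if "0 \<le> t" for t
      unfolding Y_def a_def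
      by (rule filterlim_compose[OF lugre_out_tendsto[OF s0 g_cont _ that f_cont f0]])
        (use g_pos z_sol in \<open>auto intro!: filterlim_compose[OF filterlim_real_sequentially] filterlim_Suc simp del: of_nat_Suc\<close>)
    then show "AE t in lborel. t \<ge> 0 \<longrightarrow>
        (\<lambda>k. lugre_out \<sigma>0 \<sigma>1 g f du (real (Suc k)) (z (real (Suc k))) t) \<longlonglongrightarrow> Y t"
      by simp
  qed
  have AE_P: "AE t in lborel. t \<in> {0..t4} \<longrightarrow> ycirc t = P t"
  proof (rule AE_uniform_limit_unique)
    show "\<exists>K. \<forall>k\<ge>K. AE t in lborel. t \<in> {0..t4} \<longrightarrow> \<bar>ystar (t + real k * t4) - ycirc t\<bar> \<le> \<epsilon>"
      if "0 < \<epsilon>" for \<epsilon> using ycirc_lim that by blast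
    \<comment> \<open>One null set serves all periods, as there are only countably many
      translates.\<close>
    have "AE t in lborel. \<forall>k. t + real k * t4 \<ge> 0 \<longrightarrow> ystar (t + real k * t4) = Y (t + real k * t4)"
      unfolding AE_all_countable using AE_lborel_translation[OF ystar] by blast
    then show "AE t in lborel. t \<in> {0..t4} \<longrightarrow> (\<lambda>k. ystar (t + real k * t4)) \<longlonglongrightarrow> P t"
    proof eventually_elim
      case (elim t)
      show ?case
      proof
        assume t: "t \<in> {0..t4}"
        then have "ystar (t + real k * t4) = Y (t + real k * t4)" for k
          using elim ord_t by simp
        then show "(\<lambda>k. ystar (t + real k * t4)) \<longlonglongrightarrow> P t" using Y_lim[OF t] by simp
      qed
    qed
  qed
  have cont_P: "continuous_on {0..t4} P"
  proof -
    \<comment> \<open>By \<open>Y_loop\<close> with \<open>k = 0\<close> this function is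
      \<open>P\<close>; its continuity is visible in this form without matching segments at the
      breakpoints.\<close>
    have "continuous_on {0..t4} (\<lambda>t. \<sigma>0 * limit_state a x0 t - exp (- a * var t) * (Y 0 - lg_node a (g 0) r 0))"
      unfolding limit_state_def[OF a]
      by (intro continuous_intros var_continuous indefinite_integral_continuous_1 exp_var_du_integrable a) auto
    then show ?thesis
    proof (rule continuous_on_eq)
      show "\<sigma>0 * limit_state a x0 t - exp (- a * var t) * (Y 0 - lg_node a (g 0) r 0) = P t"
        if "t \<in> {0..t4}" for t
        using Y_loop[OF that, of 0] by (simp add: Y_def del: lg_node.simps)
    qed
  qed
  have "0 < t4" using ord_t by simp
  note ycirc_P = continuous_AE_eq_imp_eq[OF this ycirc_cont cont_P AE_P]

  \<comment> \<open>Reparametrisation by the variation\<close>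
  have graph: "{(u t, ycirc t) | t. t \<in> {p..q}} =
      {(lg_psi umin1 umax1 umin2 umax2 s, lg_y a (g 0) r s) | s. s \<in> {var p..var q}}"
    if pq: "0 \<le> p" "p \<le> q" "q \<le> t4" for p q
  proof -
    \<comment> \<open>Surjectivity of \<open>var\<close> is what counts: the graphs are images, and
      \<open>u\<close> and \<open>ycirc\<close> depend on time through \<open>var\<close>
      alone.\<close>
    have img: "var ` {p..q} = {var p..var q}"
    proof
      show "var ` {p..q} \<subseteq> {var p..var q}"
        using var_increment(1) pq by auto
      show "{var p..var q} \<subseteq> var ` {p..q}"
        using IVT'[of var p _ q] var_continuous[OF pq(1)] pq(2)
        by (metis atLeastAtMost_iff imageI subsetI)
    qed
    have "{(lg_psi umin1 umax1 umin2 umax2 s, lg_y a (g 0) r s) | s. s \<in> {var p..var q}} =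
        (\<lambda>t. (lg_psi umin1 umax1 umin2 umax2 (var t), P t)) ` {p..q}"
      unfolding P_def img[symmetric] by blast
    also have "\<dots> = (\<lambda>t. (u t, ycirc t)) ` {p..q}"
      using u_psi ycirc_P pq by (intro image_cong) auto
    finally show ?thesis by blast
  qed
  have "var t1 = r 1" using var_tt[of 1] by (simp add: tt_def)
  \<comment> \<open>On the third piece \<open>u\<close> rises from \<open>umin2\<close> at
    \<open>t2\<close> to \<open>umax1\<close> at \<open>t5\<close>, so the variation exceeds
    \<open>r 2\<close> by \<open>umax1 - umin2\<close>.\<close>
  moreover have "var t5 = umax1 - umin2 + r 2"
    using var_piece(1)[of 2 t5] t5 u_vals by (simp add: tt_def)
  ultimately show ?thesis
    using graph[of 0 t4] graph[of t1 t5] ord_t t5 var_t4 by (simp add: a_def r_def)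
qed

end
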